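(* Fix $p\in(0,1)$ and let $P_n$ be the number of distinct directed source-to-sink paths in a random series-parallel network of size $n$ in the Bernoulli model with parameter $p$. Then $$\mathbb{E}(P_n)=\begin{cases}\displaystyle\sum_{j=0}^{n-1}(-1)^{n+j-1}\binom{(2p-1)j-1}{n-1}\sum_{k=0}^{n-1}\binom{k}{j}\Big(\frac{p}{2p-1}\Big)^{k}, & p\neq\tfrac12,\\[3mm] \displaystyle\sum_{k=0}^{n-1}\frac{(-1)^k}{2^k}B_k\big(-H^{(1)}_{n-1},-H^{(2)}_{n-1},-2H^{(3)}_{n-1},\dots,-(k-1)!H^{(k)}_{n-1}\big), & p=\tfrac12,\end{cases}$$ where $B_k(x_1,\dots,x_k)$ is the $k$-th complete Bell polynomial and $H^{(m)}_n=\sum_{j=1}^n j^{-m}$. Asymptotically, as $n\to\infty$, $$\mathbb{E}(P_n)=\frac{1}{1-p}\alpha_p^{\,n}+R_p(n),$$ where $\alpha_p=\Big(1-\big(\tfrac{p}{1-p}\big)^{\frac{1}{1-2p}}\Big)^{-1}$ for $p\ne\tfrac12$ and $\alpha_{1/2}=\frac{1}{1-e^{-2}}$, and $R_p(n)=-\frac{1-2p}{p\,\Gamma(2p)}n^{2p-1}+O(n^{2(2p-1)})$ for $0<p<\tfrac12$; $R_{1/2}(n)=-\frac{2}{\log n}+O\big(\frac{1}{\log^2 n}\big)$; and $R_p(n)=-\frac{2p-1}{1-p}+O(n^{1-2p})$ for $\tfrac12<p<1$.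
   Context: Bernoulli model of series-parallel networks with parameter $p\in(0,1)$: at step $1$ the network is a single edge from the source to the sink; at step $n>1$ one of the $n-1$ edges $(x,y)$ is chosen uniformly at random and with probability $p$ a parallel edge $(x,y)$ is added, with probability $1-p$ the edge is subdivided by a new vertex $z$ into $(x,z),(z,y)$. Size $n$ means the network after step $n$ ($n$ edges). Paths are directed paths following the edge orientation. Binomial coefficients with real upper argument: $\binom{a}{k}=a(a-1)\cdots(a-k+1)/k!$. *)

theory Defs
  imports "HOL-Probability.Probability" "HOL-Library.Landau_Symbols"
begin

text \<open>A network is a list of directed edges (multigraph: parallel edges are distinct
  list entries). The source is vertex 0 and the sink is vertex 1.\<close>

type_synonym network = "(nat \<times> nat) list"

definition sp_source :: nat where "sp_source = 0"
definition sp_sink :: nat where "sp_sink = 1"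

definition fresh_vertex :: "network \<Rightarrow> nat" where
  "fresh_vertex E = Suc (Max (insert sp_sink (insert sp_source (fst ` set E \<union> snd ` set E))))"

definition sp_step :: "real \<Rightarrow> network \<Rightarrow> network pmf" where
  "sp_step p E =
     bind_pmf (pmf_of_set {..<length E}) (\<lambda>i.
     bind_pmf (bernoulli_pmf p) (\<lambda>b.
       return_pmf (if b then E @ [E ! i]
                   else E[i := (fst (E ! i), fresh_vertex E)] @ [(fresh_vertex E, snd (E ! i))])))"

text \<open>sp_net p m is the random network after step m+1, i.e. of size m+1.\<close>
primrec sp_net :: "real \<Rightarrow> nat \<Rightarrow> network pmf" where
  "sp_net p 0 = return_pmf [(sp_source, sp_sink)]"
| "sp_net p (Suc m) = bind_pmf (sp_net p m) (sp_step p)"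

definition path_vertices :: "network \<Rightarrow> nat list \<Rightarrow> nat list" where
  "path_vertices E es = sp_source # map (\<lambda>i. snd (E ! i)) es"

definition st_paths :: "network \<Rightarrow> nat list set" where
  "st_paths E = {es. es \<noteq> [] \<and> set es \<subseteq> {..<length E}
     \<and> fst (E ! hd es) = sp_source
     \<and> (\<forall>k. Suc k < length es \<longrightarrow> fst (E ! (es ! Suc k)) = snd (E ! (es ! k)))
     \<and> snd (E ! last es) = sp_sink
     \<and> distinct (path_vertices E es)}"

definition num_paths :: "network \<Rightarrow> nat" where
  "num_paths E = card (st_paths E)"

definition EP :: "real \<Rightarrow> nat \<Rightarrow> real" where
  "EP p n = measure_pmf.expectation (sp_net p (n - 1)) (\<lambda>E. real (num_paths E))"

definition complete_bell :: "nat \<Rightarrow> (nat \<Rightarrow> real) \<Rightarrow> real" where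
  "complete_bell k x = (\<Sum>P\<in>{P. partition_on {1..k} P}. \<Prod>B\<in>P. x (card B))"

definition gen_harmonic :: "nat \<Rightarrow> nat \<Rightarrow> real" where
  "gen_harmonic m n = (\<Sum>j=1..n. 1 / real j ^ m)"

definition alpha_p :: "real \<Rightarrow> real" where
  "alpha_p p = (if p = 1/2 then 1 / (1 - exp (-2))
                else 1 / (1 - (p / (1 - p)) powr (1 / (1 - 2 * p))))"

definition R_p :: "real \<Rightarrow> nat \<Rightarrow> real" where
  "R_p p n = EP p n - 1 / (1 - p) * alpha_p p ^ n"

end

theory Submission
  imports Defs "HOL-Complex_Analysis.Complex_Analysis" "HOL-Real_Asymp.Real_Asymp"
begin

text \<open>For a network \<open>E\<close> with \<open>n\<close> edges let \<open>A\<^sub>E(y)\<close> be the sum of \<open>y\<close> to the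
  length over all source-to-sink paths. One growth step changes \<open>A\<^sub>E\<close>, on average over the chosen
  edge, through \<open>A\<^sub>E\<close> and \<open>y A\<^sub>E'\<close> only, since doubling an edge doubles the paths through it and
  subdividing it lengthens them by one. Hence, if \<open>\<Psi>\<close> solves \<open>(1 - z) \<Psi>' = - (1 + (2p - 1) \<Psi>)\<close>,
  \<open>\<Psi>(0) = 0\<close>, and \<open>y(z) = 1 / (1 + p \<Psi>(z))\<close>, then differentiating
  \<open>(1 - z)\<^bsup>-n\<^esup> A\<^sub>E(y(z))\<close> amounts to one growth step, and the expected number of paths has generating
  function \<open>1 / ((1 - z)(1 + p \<Psi>(z)))\<close>. Here \<open>\<Psi> = ((1 - z)\<^bsup>2p-1\<^esup> - 1) / (2p - 1)\<close>, or
  \<open>\<Psi> = log (1 - z)\<close> for \<open>p = 1/2\<close>. The geometric series in \<open>p \<Psi>\<close> gives the exact formulas.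

  On the plane slit along \<open>[1, \<infinity>)\<close> the generating function has a single simple pole at
  \<open>1 / \<alpha>\<^sub>p\<close>; once it is removed, the behaviour at \<open>z = 1\<close> determines the remainder. The transfer
  from the function to its coefficients bounds the third derivative by Cauchy's inequality on discs
  of radius \<open>|1 - z| / 3\<close> and integrates it over the circle of radius \<open>1 - 1/n\<close>.\<close>

text \<open>The number of paths does not evolve on its own: doubling an edge adds as many paths as
  run through it, so the mean increment involves the total length of the paths, whose increment in
  turn involves the sum of the squared lengths, and so on. Marking lengths by a variable closes the
  system, and letting that variable move with \<open>z\<close> along a characteristic of the
  resulting first-order equation turns differentiation into the averaged growth step.

  The transfer bound speaks of pure powers of \<open>1 - z\<close> only, whereas for
  \<open>p = 1/2\<close> the generating function behaves like
  \<open>2 / ((1 - z) log (1 - z))\<close> at \<open>1\<close>. There the logarithm is frozen at its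
  value for \<open>|1 - z| = 1/n\<close>. The comparison function then depends on \<open>n\<close>
  but is a mere simple pole at \<open>1\<close>; freezing costs a factor that is a power of
  \<open>n |1 - z|\<close>, which the transfer turns into a constant. This is why the transfer bound
  has explicit constants, treats a single \<open>n\<close>, and asks for estimates only down to
  distance \<open>1/(2n)\<close> from \<open>1\<close>.\<close>

unbundle fps_syntax
unbundle no vec_syntax

section \<open>Paths and growth steps\<close>

text \<open>\<open>st_paths\<close> speaks of positions in the list; a recursion that carries the
  current start vertex is what inductions over edge lists need. The empty walk does no harm, since
  source and sink differ.\<close>

fun walk :: "network \<Rightarrow> nat \<Rightarrow> nat list \<Rightarrow> nat \<Rightarrow> bool" where
  "walk E x [] y \<longleftrightarrow> x = y"
| "walk E x (e # es) y \<longleftrightarrow> e < length E \<and> fst (E ! e) = x \<and> walk E (snd (E ! e)) es y"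

lemma walk_iff:
  "es \<noteq> [] \<Longrightarrow> walk E x es y \<longleftrightarrow> set es \<subseteq> {..<length E} \<and> fst (E ! hd es) = x
     \<and> (\<forall>k. Suc k < length es \<longrightarrow> fst (E ! (es ! Suc k)) = snd (E ! (es ! k)))
     \<and> snd (E ! last es) = y"
proof (induction es arbitrary: x)
  case (Cons e es)
  show ?case
  proof (cases "es = []")
    case False
    have "(\<forall>k. Suc k < length (e # es) \<longrightarrow>
             fst (E ! ((e # es) ! Suc k)) = snd (E ! ((e # es) ! k))) \<longleftrightarrow>
          fst (E ! hd es) = snd (E ! e) \<and>
          (\<forall>k. Suc k < length es \<longrightarrow> fst (E ! (es ! Suc k)) = snd (E ! (es ! k)))"
      (is "?L \<longleftrightarrow> ?R")
    proof
      assume L: ?L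
      from L[rule_format, of 0] False have "fst (E ! hd es) = snd (E ! e)"
        by (simp add: hd_conv_nth)
      moreover have "fst (E ! (es ! Suc k)) = snd (E ! (es ! k))" if "Suc k < length es" for k
        using L[rule_format, of "Suc k"] that by simp
      ultimately show ?R by blast
    next
      assume R: ?R
      show ?L
      proof (intro allI impI)
        fix k assume "Suc k < length (e # es)"
        then show "fst (E ! ((e # es) ! Suc k)) = snd (E ! ((e # es) ! k))"
          using R False by (cases k) (simp_all add: hd_conv_nth)
      qed
    qed
    then show ?thesis
      using Cons.IH[OF False, of "snd (E ! e)"] False by auto
  qed auto
qed simp

lemma st_paths_walk:
  "st_paths E = {es. walk E sp_source es sp_sink \<and> distinct (path_vertices E es)}"
proof -
  have "es \<noteq> []" if "walk E sp_source es sp_sink" for es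
    using that by (auto simp: sp_source_def sp_sink_def)
  then show ?thesis
    unfolding st_paths_def using walk_iff[of _ E sp_source sp_sink] by blast
qed

lemma mem_st_paths_iff:
  "es \<in> st_paths E \<longleftrightarrow>
     walk E sp_source es sp_sink \<and> distinct (sp_source # map (\<lambda>j. snd (E ! j)) es)"
  by (simp add: st_paths_walk path_vertices_def)

lemma walk_set: "walk E x es y \<Longrightarrow> set es \<subseteq> {..<length E}"
  by (induction es arbitrary: x) auto

text \<open>A repeated edge would repeat its head among the path vertices.\<close>

lemma st_paths_distinct: "es \<in> st_paths E \<Longrightarrow> distinct es"
  by (auto simp: st_paths_walk path_vertices_def distinct_map)

lemma st_paths_set: "es \<in> st_paths E \<Longrightarrow> set es \<subseteq> {..<length E}"
  by (auto simp: st_paths_def)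

lemma finite_st_paths: "finite (st_paths E)"
proof (rule finite_subset)
  show "st_paths E \<subseteq> {es. set es \<subseteq> {..<length E} \<and> distinct es}"
    using st_paths_distinct st_paths_set by blast
  show "finite {es. set es \<subseteq> {..<length E} \<and> distinct es}"
    by (rule finite_subset_distinct) simp
qed

section \<open>Effect of doubling and of subdividing an edge on the paths\<close>

definition par_net :: "network \<Rightarrow> nat \<Rightarrow> network" where
  "par_net E i = E @ [E ! i]"

definition ser_net :: "network \<Rightarrow> nat \<Rightarrow> network" where
  "ser_net E i = E[i := (fst (E ! i), fresh_vertex E)] @ [(fresh_vertex E, snd (E ! i))]"

lemma length_par_net [simp]: "length (par_net E i) = Suc (length E)"
  and length_ser_net [simp]: "length (ser_net E i) = Suc (length E)"
  by (simp_all add: par_net_def ser_net_def)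

text \<open>Paths avoiding the copy \<open>n\<close> of edge \<open>i\<close> are the old paths.
  Paths using it correspond to the old paths through \<open>i\<close>: exchanging the two parallel
  edges changes neither the vertices nor the length.\<close>

lemma sum_st_paths_par_net:
  fixes w :: "nat \<Rightarrow> 'a :: comm_monoid_add"
  assumes i: "i < length E"
  shows "(\<Sum>es\<in>st_paths (par_net E i). w (length es)) =
           (\<Sum>es\<in>st_paths E. w (length es)) + (\<Sum>es | es \<in> st_paths E \<and> i \<in> set es. w (length es))"
proof -
  define n where "n = length E"
  define up where "up = map (\<lambda>j. if j = i then n else j)"
  define down where "down = map (\<lambda>j. if j = n then i else j)"
  let ?E = "par_net E i"
  have nth: "?E ! j = (if j = n then E ! i else E ! j)" if "j < Suc n" for j
    using that by (auto simp: par_net_def n_def nth_append)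
  have len: "length E = n" "length ?E = Suc n" by (simp_all add: n_def)
  have i': "i < n" using i by (simp add: n_def)
  have walk_low: "walk ?E x es y \<longleftrightarrow> walk E x es y" if "n \<notin> set es" for x y es
    using that
  proof (induction es arbitrary: x)
    case (Cons e es)
    show ?case
    proof (cases "e < n")
      case True
      then have "?E ! e = E ! e" by (simp add: nth)
      moreover have "walk ?E (snd (E ! e)) es y \<longleftrightarrow> walk E (snd (E ! e)) es y"
        using Cons by (intro Cons.IH) auto
      ultimately show ?thesis using True by (simp add: len)
    next
      case False
      with Cons.prems show ?thesis by (auto simp: len)
    qed
  qed simp
  have vert_low: "map (\<lambda>j. snd (?E ! j)) es = map (\<lambda>j. snd (E ! j)) es"
    if "set es \<subseteq> {..<n}" for es using that by (auto simp: nth)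
  have walk_up: "walk ?E x (up es) y" if "walk E x es y" for x y es
    using that i' by (induction es arbitrary: x) (auto simp: up_def nth len)
  have vert_up: "map (\<lambda>j. snd (?E ! j)) (up es) = map (\<lambda>j. snd (E ! j)) es"
    if "set es \<subseteq> {..<n}" for es
    using that i' by (auto simp: nth up_def subset_iff)
  have walk_down: "walk E x (down es) y" if "walk ?E x es y" for x y es
    using that i' by (induction es arbitrary: x) (auto simp: down_def nth len split: if_splits)
  have vert_down: "map (\<lambda>j. snd (E ! j)) (down es) = map (\<lambda>j. snd (?E ! j)) es"
    if "set es \<subseteq> {..<Suc n}" for es
    using that i' by (auto simp: nth down_def subset_iff)
  have up_down: "down (up es) = es" if "set es \<subseteq> {..<n}" for es
    using that i' unfolding up_def down_def map_map
    by (intro map_idI) auto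
  have 1: "{es \<in> st_paths ?E. n \<notin> set es} = st_paths E"
  proof -
    have "es \<in> st_paths ?E \<and> n \<notin> set es \<longleftrightarrow> es \<in> st_paths E" for es
    proof (cases "set es \<subseteq> {..<n}")
      case True
      then have "n \<notin> set es" by auto
      then show ?thesis
        unfolding mem_st_paths_iff vert_low[OF True] walk_low[OF \<open>n \<notin> set es\<close>] by simp
    next
      case False
      then show ?thesis
        using st_paths_set[of es ?E] st_paths_set[of es E] len
        by (auto simp: less_Suc_eq subset_iff)
    qed
    then show ?thesis by blast
  qed
  have 2: "bij_betw up {es \<in> st_paths E. i \<in> set es} {es \<in> st_paths ?E. n \<in> set es}"
  proof (rule bij_betw_byWitness[where f' = down])
    show "\<forall>es\<in>{es \<in> st_paths E. i \<in> set es}. down (up es) = es"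
      using up_down st_paths_set by (auto simp: n_def)
    show "\<forall>es\<in>{es \<in> st_paths ?E. n \<in> set es}. up (down es) = es"
    proof safe
      fix es assume es: "es \<in> st_paths ?E" "n \<in> set es"
      have "distinct (map (\<lambda>j. snd (?E ! j)) es)"
        using es(1) by (simp add: st_paths_walk path_vertices_def)
      then have "inj_on (\<lambda>j. snd (?E ! j)) (set es)" by (simp add: distinct_map)
      moreover have "snd (?E ! i) = snd (?E ! n)" using i' by (simp add: nth)
      \<comment> \<open>An edge and its copy share their head, so no path uses both; otherwise
        \<open>down\<close> would merge them and \<open>up\<close> could not undo it.\<close>
      ultimately have "i \<notin> set es"
        using es(2) i' unfolding inj_on_def by blast
      then show "up (down es) = es"
        unfolding up_def down_def map_map by (intro map_idI) auto
    qed
    show "up ` {es \<in> st_paths E. i \<in> set es} \<subseteq> {es \<in> st_paths ?E. n \<in> set es}"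
    proof safe
      fix es assume es: "es \<in> st_paths E" "i \<in> set es"
      then have s: "set es \<subseteq> {..<n}" using st_paths_set by (simp add: n_def)
      show "up es \<in> st_paths ?E"
        using es(1) walk_up unfolding mem_st_paths_iff vert_up[OF s] by blast
      show "n \<in> set (up es)" using es(2) by (auto simp: up_def)
    qed
    show "down ` {es \<in> st_paths ?E. n \<in> set es} \<subseteq> {es \<in> st_paths E. i \<in> set es}"
    proof safe
      fix es assume es: "es \<in> st_paths ?E" "n \<in> set es"
      then have s: "set es \<subseteq> {..<Suc n}" using st_paths_set len(2) by metis
      show "down es \<in> st_paths E"
        using es(1) walk_down unfolding mem_st_paths_iff vert_down[OF s] by blast
      show "i \<in> set (down es)" using es(2) by (auto simp: down_def)
    qed
  qed
  have "(\<Sum>es\<in>st_paths ?E. w (length es)) =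
      (\<Sum>es | es \<in> st_paths ?E \<and> n \<notin> set es. w (length es)) +
      (\<Sum>es | es \<in> st_paths ?E \<and> n \<in> set es. w (length es))"
    using finite_st_paths[of ?E] by (subst sum.union_disjoint [symmetric]) (auto intro!: sum.cong)
  also have "(\<Sum>es | es \<in> st_paths ?E \<and> n \<in> set es. w (length es)) =
      (\<Sum>es | es \<in> st_paths E \<and> i \<in> set es. w (length (up es)))"
    using sum.reindex_bij_betw[OF 2, of "\<lambda>es. w (length es)"] by simp
  also have "\<dots> = (\<Sum>es | es \<in> st_paths E \<and> i \<in> set es. w (length es))"
    by (simp add: up_def)
  finally show ?thesis using 1 by simp
qed

lemma fresh_vertex:
  assumes "e \<in> set E"
  shows "fst e \<noteq> fresh_vertex E" "snd e \<noteq> fresh_vertex E"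
proof -
  let ?V = "insert sp_sink (insert sp_source (fst ` set E \<union> snd ` set E))"
  have "v < fresh_vertex E" if "v \<in> ?V" for v
    unfolding fresh_vertex_def using that by (intro le_imp_less_Suc Max_ge) auto
  with assms show "fst e \<noteq> fresh_vertex E" "snd e \<noteq> fresh_vertex E" 
    by (metis UnI1 UnI2 imageI insertI2 less_irrefl)+
qed

lemma fresh_vertex_not_terminal:
  "fresh_vertex E \<noteq> sp_source" "fresh_vertex E \<noteq> sp_sink"
proof -
  let ?V = "insert sp_sink (insert sp_source (fst ` set E \<union> snd ` set E))"
  have "v < fresh_vertex E" if "v \<in> ?V" for v
    unfolding fresh_vertex_def using that by (intro le_imp_less_Suc Max_ge) auto
  then show "fresh_vertex E \<noteq> sp_source" "fresh_vertex E \<noteq> sp_sink"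
    by (metis insertCI less_irrefl)+
qed

text \<open>The fresh vertex has one incoming edge, now \<open>i\<close>, and one outgoing edge,
  \<open>n\<close>. Hence every path through \<open>i\<close> continues with \<open>n\<close>, and
  replacing \<open>i\<close> by \<open>i, n\<close> is a bijection that lengthens exactly the paths
  through \<open>i\<close>.\<close>

lemma sum_st_paths_ser_net:
  fixes w :: "nat \<Rightarrow> 'a :: comm_monoid_add"
  assumes i: "i < length E"
  shows "(\<Sum>es\<in>st_paths (ser_net E i). w (length es)) =
           (\<Sum>es\<in>st_paths E. w (length es + of_bool (i \<in> set es)))"
proof -
  define n where "n = length E"
  define v where "v = fresh_vertex E"
  define up where "up = (\<lambda>es. concat (map (\<lambda>j. if j = i then [i, n] else [j]) es))"
  let ?E = "ser_net E i"
  let ?V = "\<lambda>es. map (\<lambda>j. snd (E ! j)) es" and ?V' = "\<lambda>es. map (\<lambda>j. snd (?E ! j)) es"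
  have up_simps [simp]: "up [] = []" "up (j # es) = (if j = i then i # n # up es else j # up es)"
    for j es by (auto simp: up_def)
  have nth: "?E ! j = (if j = n then (v, snd (E ! i)) else if j = i then (fst (E ! i), v) else E ! j)"
    if "j < Suc n" for j
    using that i by (auto simp: ser_net_def n_def v_def nth_append)
  have len: "length ?E = Suc n" by (simp add: n_def)
  have i': "i < n" using i by (simp add: n_def)
  have fresh: "fst (E ! j) \<noteq> v" "snd (E ! j) \<noteq> v" if "j < n" for j
    using fresh_vertex[of "E ! j" E] that by (auto simp: v_def n_def)
  have nt: "v \<noteq> sp_source" "v \<noteq> sp_sink"
    unfolding v_def by (rule fresh_vertex_not_terminal)+
  have walk_up: "walk ?E x (up es) y" if "walk E x es y" for x y es
    using that i' by (induction es arbitrary: x) (auto simp: nth len n_def[symmetric])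
  \<comment> \<open>Induction on the length rather than on the list, since the pair
    \<open>i, n\<close> is consumed at once. The endpoints must differ from the fresh vertex, or the
    pair could be cut in two.\<close>
  have up_surj: "\<exists>es'. es = up es' \<and> walk E x es' y" if "walk ?E x es y" "x \<noteq> v" "y \<noteq> v" for x y es
    using that
  proof (induction "length es" arbitrary: es x rule: less_induct)
    case less
    show ?case
    proof (cases es)
      case Nil
      with less.prems show ?thesis by (intro exI[of _ "[]"]) auto
    next
      case (Cons e es1)
      with less.prems have e: "e < Suc n" "fst (?E ! e) = x" "walk ?E (snd (?E ! e)) es1 y"
        using len by (auto simp del: length_ser_net)
      have "e \<noteq> n" using e less.prems(2) by (auto simp: nth)
      show ?thesis
      proof (cases "e = i")
        case False
        then have "snd (?E ! e) = snd (E ! e)" "fst (?E ! e) = fst (E ! e)" "e < n"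
          using e \<open>e \<noteq> n\<close> by (auto simp: nth)
        moreover from this obtain es' where "es1 = up es'" "walk E (snd (E ! e)) es' y"
          using less.hyps[of es1 "snd (?E ! e)"] e Cons less.prems(3) fresh by auto
        ultimately show ?thesis using Cons False e
          by (intro exI[of _ "e # es'"]) (auto simp: n_def)
      next
        case True
        then have w: "walk ?E v es1 y" using e i' by (simp add: nth)
        with less.prems(3) obtain e2 es2 where es1: "es1 = e2 # es2" by (cases es1) auto
        with w have e2: "e2 < Suc n" "fst (?E ! e2) = v" "walk ?E (snd (?E ! e2)) es2 y"
          using len by (auto simp del: length_ser_net)
        \<comment> \<open>All other edges still start at an old vertex.\<close>
        have "e2 = n"
        proof (rule ccontr)
          assume "e2 \<noteq> n"
          with e2(1) have "e2 < n" by simp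
          with e2(2) fresh[of e2] fresh[OF i'] show False by (auto simp: nth split: if_splits)
        qed
        with e2 have w2: "walk ?E (snd (E ! i)) es2 y" by (simp add: nth)
        then obtain es' where "es2 = up es'" "walk E (snd (E ! i)) es' y"
          using less.hyps[of es2 "snd (E ! i)"] Cons es1 less.prems(3) fresh i' by auto
        moreover have "fst (E ! i) = x" using e True i' by (simp add: nth)
        ultimately show ?thesis using Cons True es1 \<open>e2 = n\<close> i
          by (intro exI[of _ "i # es'"]) auto
      qed
    qed
  qed
  have setV: "set (?V' (up es)) = set (?V es) \<union> (if i \<in> set es then {v} else {})"
    if "set es \<subseteq> {..<n}" for es
    using that i' by (induction es) (auto simp: nth)
  have dist1: "distinct (x # ?V' (up es))" if "distinct (x # ?V es)" "set es \<subseteq> {..<n}" "x \<noteq> v" for x es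
    using that
  proof (induction es arbitrary: x)
    case (Cons e es)
    have IH: "distinct (snd (E ! e) # ?V' (up es))"
      using Cons.prems fresh by (intro Cons.IH) auto
    show ?case
    proof (cases "e = i")
      case True
      with Cons.prems have "i \<notin> set es" by auto
      then have "v \<notin> set (?V' (up es))" using setV[of es] Cons.prems fresh by auto
      then show ?thesis using IH True i' Cons.prems setV[of es] fresh[OF i'] by (auto simp: nth)
    next
      case False
      then show ?thesis using IH Cons.prems setV[of es] by (auto simp: nth)
    qed
  qed simp
  \<comment> \<open>Deleting the fresh vertex recovers the old vertex sequence, so distinctness is
    inherited backwards.\<close>
  have filt: "filter (\<lambda>x. x \<noteq> v) (?V' (up es)) = ?V es" if "set es \<subseteq> {..<n}" for es
    using that i' by (induction es) (auto simp: nth fresh)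
  have dist2: "distinct (sp_source # ?V es)" if "distinct (sp_source # ?V' (up es))" "set es \<subseteq> {..<n}" for es
  proof -
    have "distinct (filter (\<lambda>x. x \<noteq> v) (sp_source # ?V' (up es)))"
      using that(1) by (rule distinct_filter)
    then show ?thesis using filt[OF that(2)] nt by simp
  qed
  have down_up: "filter (\<lambda>j. j \<noteq> n) (up es) = es" if "set es \<subseteq> {..<n}" for es
    using that i' by (induction es) auto
  have bij: "bij_betw up (st_paths E) (st_paths ?E)"
    unfolding bij_betw_def
  proof (intro conjI equalityI subsetI)
    show "inj_on up (st_paths E)"
      by (rule inj_on_inverseI[where g = "filter (\<lambda>j. j \<noteq> n)"])
         (use down_up st_paths_set in \<open>auto simp: n_def\<close>)
  next
    fix es assume "es \<in> up ` st_paths E"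
    then obtain es' where es': "es = up es'" "es' \<in> st_paths E" by auto
    then have "set es' \<subseteq> {..<n}" using st_paths_set by (simp add: n_def)
    with es' nt show "es \<in> st_paths ?E"
      using dist1[of sp_source es'] walk_up by (simp add: st_paths_walk path_vertices_def)
  next
    fix es assume "es \<in> st_paths ?E"
    then have es: "walk ?E sp_source es sp_sink" "distinct (sp_source # ?V' es)"
      by (simp_all add: st_paths_walk path_vertices_def)
    with up_surj nt obtain es' where es': "es = up es'" "walk E sp_source es' sp_sink" by metis
    then have "set es' \<subseteq> {..<n}" using walk_set by (simp add: n_def)
    with es es' dist2 have "es' \<in> st_paths E" by (simp add: st_paths_walk path_vertices_def)
    with es' show "es \<in> up ` st_paths E" by blast
  qed
  have len_up: "length (up es) = length es + of_bool (i \<in> set es)" if "distinct es" for es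
    using that by (induction es) auto
  show ?thesis
    unfolding sum.reindex_bij_betw[OF bij, symmetric]
    by (intro sum.cong) (auto simp: len_up st_paths_distinct)
qed

section \<open>The generating function of the expected number of paths\<close>

text \<open>A general semiring, because the argument will be a formal power series.\<close>

definition path_poly :: "network \<Rightarrow> 'a::comm_semiring_1 \<Rightarrow> 'a" where
  "path_poly E y = (\<Sum>es\<in>st_paths E. y ^ length es)"

text \<open>Double counting of pairs of a path and an edge on it: a path has as many edges as its
  length, its edges being distinct. This is how the derivative in the length variable
  arises.\<close>

lemma sum_st_paths_edges:
  fixes w :: "nat list \<Rightarrow> 'a :: comm_semiring_1"
  shows "(\<Sum>i<length E. \<Sum>es | es \<in> st_paths E \<and> i \<in> set es. w es) =
           (\<Sum>es\<in>st_paths E. of_nat (length es) * w es)"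
proof -
  have "(\<Sum>i<length E. \<Sum>es | es \<in> st_paths E \<and> i \<in> set es. w es) =
        (\<Sum>i<length E. \<Sum>es\<in>st_paths E. if i \<in> set es then w es else 0)"
    by (intro sum.cong refl sum.inter_filter finite_st_paths)
  also have "\<dots> = (\<Sum>es\<in>st_paths E. \<Sum>i<length E. if i \<in> set es then w es else 0)"
    by (rule sum.swap)
  also have "\<dots> = (\<Sum>es\<in>st_paths E. of_nat (length es) * w es)"
  proof (intro sum.cong refl)
    fix es assume es: "es \<in> st_paths E"
    have "(\<Sum>i<length E. if i \<in> set es then w es else 0) = (\<Sum>i | i \<in> {..<length E} \<and> i \<in> set es. w es)"
      by (rule sum.inter_filter[symmetric]) simp
    also have "{i. i \<in> {..<length E} \<and> i \<in> set es} = set es"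
      using st_paths_set[OF es] by blast
    finally show "(\<Sum>i<length E. if i \<in> set es then w es else 0) = of_nat (length es) * w es"
      using st_paths_distinct[OF es] by (simp add: distinct_card)
  qed
  finally show ?thesis .
qed

lemma sum_path_poly_par_net:
  fixes y :: "'a :: comm_ring_1"
  shows "(\<Sum>i<length E. path_poly (par_net E i) y) =
           (\<Sum>es\<in>st_paths E. of_nat (length E + length es) * y ^ length es)"
proof -
  have "(\<Sum>i<length E. path_poly (par_net E i) y) =
      of_nat (length E) * path_poly E y + (\<Sum>i<length E. \<Sum>es | es \<in> st_paths E \<and> i \<in> set es. y ^ length es)"
    using sum_st_paths_par_net[where w = "\<lambda>k. y ^ k" and E = E]
    by (simp add: path_poly_def sum.distrib)
  also have "\<dots> = (\<Sum>es\<in>st_paths E. of_nat (length E + length es) * y ^ length es)"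
    unfolding sum_st_paths_edges path_poly_def
    by (simp add: sum_distrib_left sum.distrib algebra_simps)
  finally show ?thesis .
qed

lemma sum_path_poly_ser_net:
  fixes y :: "'a :: comm_ring_1"
  shows "(\<Sum>i<length E. path_poly (ser_net E i) y) =
           (\<Sum>es\<in>st_paths E. (of_nat (length E) + of_nat (length es) * (y - 1)) * y ^ length es)"
proof -
  \<comment> \<open>A path through the subdivided edge gains a factor \<open>y\<close>, that is,
    \<open>y - 1\<close> times its old weight on top of that weight.\<close>
  have "path_poly (ser_net E i) y = path_poly E y + (\<Sum>es | es \<in> st_paths E \<and> i \<in> set es. (y - 1) * y ^ length es)"
    if "i < length E" for i
  proof -
    have "path_poly (ser_net E i) y = (\<Sum>es\<in>st_paths E. y ^ (length es + of_bool (i \<in> set es)))"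
      using sum_st_paths_ser_net[OF that, of "\<lambda>k. y ^ k"] by (simp add: path_poly_def)
    also have "\<dots> = (\<Sum>es\<in>st_paths E. y ^ length es + (if i \<in> set es then (y - 1) * y ^ length es else 0))"
      by (intro sum.cong) (auto simp: algebra_simps)
    finally show ?thesis
      by (simp add: path_poly_def sum.distrib sum.inter_filter finite_st_paths)
  qed
  then have "(\<Sum>i<length E. path_poly (ser_net E i) y) =
      of_nat (length E) * path_poly E y + (\<Sum>i<length E. \<Sum>es | es \<in> st_paths E \<and> i \<in> set es. (y - 1) * y ^ length es)"
    by (simp add: sum.distrib)
  also have "\<dots> = (\<Sum>es\<in>st_paths E. (of_nat (length E) + of_nat (length es) * (y - 1)) * y ^ length es)"
    unfolding sum_st_paths_edges path_poly_def
    by (simp add: sum_distrib_left sum.distrib ring_distribs mult.assoc)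
  finally show ?thesis .
qed

text \<open>For a path of length \<open>l\<close> in a network with \<open>n\<close> edges, the two
  growth operations contribute \<open>p (n + l) + (1 - p) (n + l (Y - 1)) = n + l ((1 - p) Y + 2p -
  1)\<close>. The equations for \<open>G\<close> and \<open>Y\<close> are chosen so that the product
  rule gives just this factor, and the additional \<open>G\<close> accounts for the new
  edge.\<close>

lemma path_count_gf_deriv:
  fixes Y G :: "real fps"
  assumes G: "fps_deriv G = G * G"
    and Y: "fps_deriv Y = G * (fps_const (1 - p) * Y + fps_const (2 * p - 1)) * Y"
  defines "S \<equiv> \<lambda>E. G ^ length E * path_poly E Y"
  shows "fps_deriv (S E) = (\<Sum>i<length E. fps_const p * S (par_net E i) + fps_const (1 - p) * S (ser_net E i))"
proof -
  define n where "n = length E"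
  have pow: "fps_deriv (F ^ k) = of_nat k * C * F ^ k" if "fps_deriv F = C * F" for k and F C :: "real fps"
    by (induction k) (simp_all add: that algebra_simps)
  note powG = pow[OF G] and powY = pow[OF Y]
  have "fps_deriv (S E) =
      (\<Sum>es\<in>st_paths E. G ^ Suc n * (of_nat n + of_nat (length es) * (fps_const (1 - p) * Y + fps_const (2 * p - 1))) * Y ^ length es)"
    unfolding S_def path_poly_def n_def
    by (simp add: powG powY fps_deriv_sum sum_distrib_left sum.distrib algebra_simps)
  also have "\<dots> = (\<Sum>es\<in>st_paths E. G ^ Suc n * (fps_const p * (of_nat (n + length es) * Y ^ length es) +
      fps_const (1 - p) * ((of_nat n + of_nat (length es) * (Y - 1)) * Y ^ length es)))"
  proof (intro sum.cong refl)
    fix es :: "nat list"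
    have c: "fps_const (1 - p) = 1 - fps_const p" "fps_const (2 * p - 1) = 2 * fps_const p - 1"
      by (simp_all flip: fps_const_sub fps_const_mult add: numeral_fps_const)
    show "G ^ Suc n * (of_nat n + of_nat (length es) * (fps_const (1 - p) * Y + fps_const (2 * p - 1))) * Y ^ length es =
      G ^ Suc n * (fps_const p * (of_nat (n + length es) * Y ^ length es) +
      fps_const (1 - p) * ((of_nat n + of_nat (length es) * (Y - 1)) * Y ^ length es))"
      unfolding c by (simp add: algebra_simps)
  qed
  also have "\<dots> = G ^ Suc n * (fps_const p * (\<Sum>i<length E. path_poly (par_net E i) Y) +
      fps_const (1 - p) * (\<Sum>i<length E. path_poly (ser_net E i) Y))"
    unfolding sum_path_poly_par_net sum_path_poly_ser_net n_def
    by (simp add: sum_distrib_left sum.distrib ring_distribs)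
  also have "\<dots> = (\<Sum>i<length E. fps_const p * S (par_net E i) + fps_const (1 - p) * S (ser_net E i))"
    by (simp add: S_def n_def sum_distrib_left sum.distrib algebra_simps)
  finally show ?thesis .
qed

section \<open>From one random step to the expectation\<close>

lemma sp_step_expectation:
  fixes h :: "network \<Rightarrow> real"
  assumes p: "0 \<le> p" "p \<le> 1" and E: "E \<noteq> []"
  shows "measure_pmf.expectation (sp_step p E) h =
           (\<Sum>i<length E. p * h (par_net E i) + (1 - p) * h (ser_net E i)) / real (length E)"
proof -
  have step: "sp_step p E = bind_pmf (pmf_of_set {..<length E})
      (\<lambda>i. map_pmf (\<lambda>b. if b then par_net E i else ser_net E i) (bernoulli_pmf p))"
    unfolding sp_step_def par_net_def ser_net_def map_pmf_def ..
  have "measure_pmf.expectation (sp_step p E) h =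
      (\<Sum>i<length E. measure_pmf.expectation
         (map_pmf (\<lambda>b. if b then par_net E i else ser_net E i) (bernoulli_pmf p)) h /\<^sub>R real (card {..<length E}))"
    unfolding step using E by (intro pmf_expectation_bind_pmf_of_set) auto
  also have "\<dots> = (\<Sum>i<length E. (p * h (par_net E i) + (1 - p) * h (ser_net E i)) / real (length E))"
    using p by (simp add: divide_inverse mult.commute)
  finally show ?thesis by (simp add: sum_divide_distrib)
qed

lemma sp_step_support: "E' \<in> set_pmf (sp_step p E) \<Longrightarrow> E \<noteq> [] \<Longrightarrow> length E' = Suc (length E)"
  by (auto simp: sp_step_def split: if_splits)

lemma finite_sp_step: "E \<noteq> [] \<Longrightarrow> finite (set_pmf (sp_step p E))"
  by (simp add: sp_step_def lessThan_empty_iff)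

lemma sp_net_support: "E \<in> set_pmf (sp_net p m) \<Longrightarrow> length E = Suc m"
proof (induction m arbitrary: E)
  case (Suc m)
  then obtain E0 where "E0 \<in> set_pmf (sp_net p m)" "E \<in> set_pmf (sp_step p E0)" by auto
  then show ?case using Suc.IH[of E0] sp_step_support[of E p E0] by fastforce
qed simp

lemma finite_sp_net: "finite (set_pmf (sp_net p m))"
proof (induction m)
  case (Suc m)
  have "E \<noteq> []" if "E \<in> set_pmf (sp_net p m)" for E
    using sp_net_support[OF that] by auto
  then show ?case using Suc by (auto simp: finite_sp_step)
qed simp

lemma st_paths_single: "st_paths [(sp_source, sp_sink)] = {[0]}"
proof (intro set_eqI iffI)
  fix es assume es: "es \<in> st_paths [(sp_source, sp_sink)]"
  then have "set es \<subseteq> {0}" "distinct es" "es \<noteq> []"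
    using st_paths_set[OF es] st_paths_distinct[OF es] by (auto simp: st_paths_def)
  then show "es \<in> {[0]}"
    by (cases es; cases "tl es") auto
qed (auto simp: mem_st_paths_iff sp_source_def sp_sink_def)

lemma EP_eq_coeff:
  fixes Y G :: "real fps"
  assumes p: "0 \<le> p" "p \<le> 1"
    and G: "fps_deriv G = G * G" "G $ 0 = 1"
    and Y: "fps_deriv Y = G * (fps_const (1 - p) * Y + fps_const (2 * p - 1)) * Y" "Y $ 0 = 1"
  shows "EP p (Suc m) = (G * Y) $ m"
proof -
  \<comment> \<open>Up to normalisation, the \<open>k\<close>-th coefficient of \<open>S E\<close> is the expected number of paths after
    \<open>k\<close> growth steps started at \<open>E\<close>.\<close>
  define S where "S = (\<lambda>E. G ^ length E * path_poly E Y)"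
  have S0: "S E $ 0 = real (num_paths E)" for E
    by (simp add: S_def path_poly_def num_paths_def fps_sum_nth fps_power_zeroth G Y)
  have step: "real (length E) * measure_pmf.expectation (sp_step p E) (\<lambda>E'. S E' $ k) = real (Suc k) * S E $ Suc k"
    if "E \<noteq> []" for E k
  proof -
    have "real (length E) * measure_pmf.expectation (sp_step p E) (\<lambda>E'. S E' $ k) = fps_deriv (S E) $ k"
      unfolding S_def path_count_gf_deriv[OF G(1) Y(1)] sp_step_expectation[OF p that]
      using that by (simp add: fps_sum_nth)
    then show ?thesis by simp
  qed
  \<comment> \<open>Each induction step trades one differentiation for one growth step. The uniform
    choice divides by the number \<open>m + 1\<close> of edges, which is the factor that turns
    \<open>m!\<close> into \<open>(m + 1)!\<close>. For \<open>m = k\<close> only constant terms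
    remain, and these count paths.\<close>
  have main: "fact k * (S [(sp_source, sp_sink)]) $ (k) =
      fact m * fact (k - m) * measure_pmf.expectation (sp_net p m) (\<lambda>E. S E $ (k - m))" if "m \<le> k" for m k
    using that
  proof (induction m)
    case (Suc m)
    have ne: "E \<noteq> []" if "E \<in> set_pmf (sp_net p m)" for E
      using sp_net_support[OF that] by auto
    have km: "k - m = Suc (k - Suc m)" using Suc.prems by simp
    have average: "real (Suc m) * measure_pmf.expectation (sp_step p E) (\<lambda>E. S E $ (k - Suc m)) =
        real (k - m) * S E $ (k - m)" if E: "E \<in> set_pmf (sp_net p m)" for E
      unfolding km using step[OF ne[OF E], of "k - Suc m"] sp_net_support[OF E] by simp
    have "fact (Suc m) * measure_pmf.expectation (sp_net p (Suc m)) (\<lambda>E. S E $ (k - Suc m)) =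
        fact m * (\<Sum>E\<in>set_pmf (sp_net p m). pmf (sp_net p m) E * 
          (real (Suc m) * measure_pmf.expectation (sp_step p E) (\<lambda>E. S E $ (k - Suc m))))"
      unfolding sp_net.simps
      by (subst pmf_expectation_bind[OF finite_sp_net])
         (auto simp: finite_sp_step ne sum_distrib_left algebra_simps)
    also have "\<dots> = fact m * (\<Sum>E\<in>set_pmf (sp_net p m). pmf (sp_net p m) E * (real (k - m) * S E $ (k - m)))"
      by (rule arg_cong[where f = "(*) (fact m)"], rule sum.cong[OF refl], simp only: average)
    also have "\<dots> = fact m * real (k - m) * measure_pmf.expectation (sp_net p m) (\<lambda>E. S E $ (k - m))"
      by (subst integral_measure_pmf[of "set_pmf (sp_net p m)"])
         (auto simp: finite_sp_net sum_distrib_left algebra_simps)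
    finally have eq: "fact (Suc m) * measure_pmf.expectation (sp_net p (Suc m)) (\<lambda>E. S E $ (k - Suc m)) =
        fact m * real (k - m) * measure_pmf.expectation (sp_net p m) (\<lambda>E. S E $ (k - m))" .
    have "fact (Suc m) * fact (k - Suc m) * measure_pmf.expectation (sp_net p (Suc m)) (\<lambda>E. S E $ (k - Suc m)) =
        fact (k - Suc m) * (fact (Suc m) * measure_pmf.expectation (sp_net p (Suc m)) (\<lambda>E. S E $ (k - Suc m)))"
      by (simp only: mult_ac)
    also have "\<dots> = fact m * fact (k - m) * measure_pmf.expectation (sp_net p m) (\<lambda>E. S E $ (k - m))"
      unfolding eq by (simp add: km)
    finally show ?case using Suc by simp
  qed simp
  have "fact m * S [(sp_source, sp_sink)] $ m = fact m * EP p (Suc m)"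
    using main[of m m] by (simp add: EP_def S0)
  moreover have "S [(sp_source, sp_sink)] = G * Y"
    by (simp add: S_def path_poly_def st_paths_single)
  ultimately show ?thesis by simp
qed

section \<open>Exact formulas\<close>

abbreviation fps_geo :: "real fps" where
  "fps_geo \<equiv> inverse (1 - fps_X)"

lemma fps_geo_mult: "(1 - fps_X) * fps_geo = 1"
  by (rule inverse_mult_eq_1') simp

lemma fps_geo_nth [simp]: "fps_geo $ n = 1"
proof -
  have "(1 - fps_X) * Abs_fps (\<lambda>n. 1 :: real) = 1"
  proof (rule fps_ext)
    fix n show "((1 - fps_X) * Abs_fps (\<lambda>n. 1 :: real)) $ n = (1 :: real fps) $ n"
      by (cases n) (simp_all add: left_diff_distrib)
  qed
  then have "fps_geo = Abs_fps (\<lambda>n. 1)"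
    by (rule fps_inverse_unique)
  then show ?thesis by simp
qed

lemma fps_deriv_fps_geo: "fps_deriv fps_geo = fps_geo * fps_geo"
  by (simp add: fps_inverse_deriv power2_eq_square)

text \<open>The equation for \<open>Y\<close> is quadratic, but its reciprocal
  \<open>D = 1 / Y\<close> satisfies the linear equation
  \<open>D' = - G ((1 - p) + (2p - 1) D)\<close>, and \<open>D = 1 + p \<Psi>\<close> brings it to
  the form assumed here.\<close>

lemma EP_eq_coeff_psi:
  fixes \<Psi> :: "real fps"
  assumes p: "0 \<le> p" "p \<le> 1"
    and \<Psi>: "(1 - fps_X) * fps_deriv \<Psi> = - (1 + fps_const (2 * p - 1) * \<Psi>)" "\<Psi> $ 0 = 0"
  shows "EP p (Suc m) = (fps_geo * inverse (1 + fps_const p * \<Psi>)) $ m"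
proof (rule EP_eq_coeff[OF p fps_deriv_fps_geo])
  define D where "D = 1 + fps_const p * \<Psi>"
  have D0: "D $ 0 = 1" by (simp add: D_def \<Psi>)
  have inv: "D * inverse D = 1" by (rule inverse_mult_eq_1') (simp add: D0)
  have "fps_deriv \<Psi> = fps_geo * ((1 - fps_X) * fps_deriv \<Psi>)"
    using fps_geo_mult by (metis mult.assoc mult.commute mult_1)
  then have dPsi: "fps_deriv \<Psi> = - fps_geo * (1 + fps_const (2 * p - 1) * \<Psi>)"
    unfolding \<Psi>(1) by (simp only: mult_minus_left mult_minus_right)
  have c: "fps_const (1 - p) = 1 - fps_const p" "fps_const (2 * p - 1) = 2 * fps_const p - 1"
    by (simp_all flip: fps_const_sub fps_const_mult add: numeral_fps_const)
  have D': "fps_deriv D = - fps_geo * (fps_const (1 - p) + fps_const (2 * p - 1) * D)"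
  proof -
    have "fps_deriv D = fps_const p * fps_deriv \<Psi>" by (simp add: D_def)
    then show ?thesis unfolding dPsi c D_def by (simp add: algebra_simps)
  qed
  have "fps_deriv (inverse D) = - fps_deriv D * (inverse D)\<^sup>2"
    by (rule fps_inverse_deriv) (simp add: D0)
  also have "\<dots> = fps_geo * (fps_const (1 - p) * inverse D + fps_const (2 * p - 1) * (D * inverse D)) * inverse D"
    unfolding D' by (simp add: algebra_simps power2_eq_square)
  finally have "fps_deriv (inverse D) = fps_geo * (fps_const (1 - p) * inverse D + fps_const (2 * p - 1)) * inverse D"
    unfolding inv by simp
  then show "fps_deriv (inverse (1 + fps_const p * \<Psi>)) =
      fps_geo * (fps_const (1 - p) * inverse (1 + fps_const p * \<Psi>) + fps_const (2 * p - 1)) *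
      inverse (1 + fps_const p * \<Psi>)"
    unfolding D_def .
qed (simp_all add: \<Psi>)

text \<open>Since \<open>Q ^ k\<close> starts in degree \<open>k\<close> or later, the geometric
  series may stop at \<open>k = m\<close>; this is why the sums in the exact formulas are
  finite.\<close>

lemma fps_inverse_geometric_nth:
  fixes F Q :: "'a :: field fps"
  assumes "Q $ 0 = 0"
  shows "(F * inverse (1 - Q)) $ m = (\<Sum>k\<le>m. (F * Q ^ k) $ m)"
proof -
  have inv: "(1 - Q) * inverse (1 - Q) = 1" by (rule inverse_mult_eq_1') (simp add: assms)
  have "(1 - Q) * (\<Sum>k\<le>m. Q ^ k) = 1 - Q ^ Suc m"
    using sum_gp_basic[of Q m] by simp
  then have "inverse (1 - Q) * ((1 - Q) * (\<Sum>k\<le>m. Q ^ k)) = inverse (1 - Q) - inverse (1 - Q) * Q ^ Suc m"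
    by (simp only: right_diff_distrib mult_1_right)
  moreover have "inverse (1 - Q) * ((1 - Q) * (\<Sum>k\<le>m. Q ^ k)) = (\<Sum>k\<le>m. Q ^ k)"
    using inv by (metis mult.assoc mult.commute mult_1)
  ultimately have "inverse (1 - Q) = (\<Sum>k\<le>m. Q ^ k) + inverse (1 - Q) * Q ^ Suc m"
    by simp
  then have eq: "F * inverse (1 - Q) = (\<Sum>k\<le>m. F * Q ^ k) + (F * inverse (1 - Q)) * Q ^ Suc m"
    by (metis (no_types) distrib_left mult.assoc sum_distrib_left)
  have zero: "((F * inverse (1 - Q)) * Q ^ Suc m) $ m = 0"
    unfolding fps_mult_nth using startsby_zero_power_prefix[OF assms, of "Suc m"]
    by (intro sum.neutral) (auto simp: less_Suc_eq_le)
  have "(F * inverse (1 - Q)) $ m = (\<Sum>k\<le>m. F * Q ^ k) $ m + ((F * inverse (1 - Q)) * Q ^ Suc m) $ m"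
    by (subst eq) (rule fps_add_nth)
  then show ?thesis unfolding zero by (simp add: fps_sum_nth)
qed

lemma EP_eq_psi_sum:
  fixes \<Psi> :: "real fps"
  assumes p: "0 \<le> p" "p \<le> 1"
    and \<Psi>: "(1 - fps_X) * fps_deriv \<Psi> = - (1 + fps_const (2 * p - 1) * \<Psi>)" "\<Psi> $ 0 = 0"
  shows "EP p (Suc m) = (\<Sum>k\<le>m. (- p) ^ k * (fps_geo * \<Psi> ^ k) $ m)"
proof -
  have "EP p (Suc m) = (fps_geo * inverse (1 - fps_const (- p) * \<Psi>)) $ m"
    using EP_eq_coeff_psi[OF assms] by (simp flip: fps_const_neg)
  also have "\<dots> = (\<Sum>k\<le>m. (fps_geo * (fps_const (- p) * \<Psi>) ^ k) $ m)"
    by (rule fps_inverse_geometric_nth) (simp add: \<Psi>)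
  also have "\<dots> = (\<Sum>k\<le>m. (fps_const ((- p) ^ k) * (fps_geo * \<Psi> ^ k)) $ m)"
    by (intro sum.cong refl arg_cong[where f = "\<lambda>F. F $ m"])
       (simp only: power_mult_distrib fps_const_power mult_ac)
  finally show ?thesis by simp
qed

section \<open>Powers of \<open>1 - z\<close> and the exact formula for
  \<open>p \<noteq> 1/2\<close>\<close>

definition fps_one_minus_powr :: "real \<Rightarrow> real fps" where
  "fps_one_minus_powr c = Abs_fps (\<lambda>n. (-1) ^ n * (c gchoose n))"

lemma fps_one_minus_powr_nth [simp]: "fps_one_minus_powr c $ n = (-1) ^ n * (c gchoose n)"
  by (simp add: fps_one_minus_powr_def)

lemma fps_one_minus_powr_compose:
  "fps_one_minus_powr c = fps_compose (fps_binomial c) (fps_const (-1) * fps_X)"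
  unfolding fps_compose_linear by (simp add: fps_one_minus_powr_def)

lemma fps_one_minus_powr_add:
  "fps_one_minus_powr (c + d) = fps_one_minus_powr c * fps_one_minus_powr d"
  unfolding fps_one_minus_powr_compose fps_binomial_add_mult
  by (rule fps_compose_mult_distrib) simp

lemma fps_one_minus_powr_power: "fps_one_minus_powr c ^ k = fps_one_minus_powr (real k * c)"
proof (induction k)
  case (Suc k)
  then show ?case by (simp add: ring_distribs fps_one_minus_powr_add)
qed (simp add: fps_eq_iff gbinomial_0_left)

lemma fps_one_minus_powr_minus_one: "fps_one_minus_powr (- 1) = fps_geo"
proof -
  have "fps_one_minus_powr 1 = 1 - fps_X"
    unfolding fps_one_minus_powr_compose fps_binomial_1
    by (subst fps_compose_add_distrib) (simp flip: fps_const_neg)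
  moreover have "fps_one_minus_powr 0 = 1"
    using fps_one_minus_powr_power[of _ 0] by simp
  ultimately have "(1 - fps_X) * fps_one_minus_powr (- 1) = 1"
    using fps_one_minus_powr_add[of 1 "-1"] by simp
  then show ?thesis
    by (intro fps_inverse_unique[symmetric])
qed

lemma fps_one_minus_powr_deriv:
  "(1 - fps_X) * fps_deriv (fps_one_minus_powr c) = fps_const (- c) * fps_one_minus_powr c"
proof (rule fps_ext)
  fix n
  let ?b = "fps_one_minus_powr c"
  have "((1 - fps_X) * fps_deriv ?b) $ n = real (Suc n) * ?b $ Suc n - real n * ?b $ n"
    by (cases n) (simp_all add: left_diff_distrib)
  also have "\<dots> = - ((-1) ^ n * (real n * (c gchoose n) + real (Suc n) * (c gchoose Suc n)))"
    by (simp add: algebra_simps)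
  also have "\<dots> = (fps_const (- c) * ?b) $ n"
    unfolding gbinomial_mult_1[symmetric] by simp
  finally show "((1 - fps_X) * fps_deriv ?b) $ n = (fps_const (- c) * ?b) $ n" .
qed

text \<open>With \<open>s = 2p - 1\<close> one has
  \<open>- p \<Psi> = (p / s) (1 - (1 - z)^s)\<close>. The binomial theorem for the
  \<open>k\<close>-th power, together with the factor \<open>1 / (1 - z)\<close>, leaves the powers
  \<open>(1 - z)^(s j - 1)\<close>.\<close>

lemma EP_generic:
  assumes p: "0 < p" "p < 1" "p \<noteq> 1/2"
  shows "EP p (Suc m) = (\<Sum>j\<le>m. (-1) ^ (m + j) * (((2*p - 1) * real j - 1) gchoose m)
               * (\<Sum>k\<le>m. real (k choose j) * (p / (2*p - 1)) ^ k))"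
proof -
  define s where "s = 2 * p - 1"
  have s: "s \<noteq> 0" using p by (simp add: s_def)
  define B where "B = fps_one_minus_powr s"
  define \<Psi> where "\<Psi> = fps_const (1 / s) * (B - 1)"
  have B: "fps_const s * \<Psi> + 1 = B" using s by (simp add: \<Psi>_def flip: mult.assoc)
  have "(1 - fps_X) * fps_deriv \<Psi> = fps_const (1 / s) * ((1 - fps_X) * fps_deriv B)"
    by (simp add: \<Psi>_def mult_ac)
  also have "\<dots> = - B" unfolding B_def fps_one_minus_powr_deriv using s
    by (simp flip: mult.assoc fps_const_neg)
  finally have ode: "(1 - fps_X) * fps_deriv \<Psi> = - (1 + fps_const (2 * p - 1) * \<Psi>)"
    using B by (simp add: s_def add.commute)
  have \<Psi>0: "\<Psi> $ 0 = 0" by (simp add: \<Psi>_def B_def)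
  have coeff: "(- p) ^ k * (fps_geo * \<Psi> ^ k) $ m =
      (\<Sum>j\<le>m. (-1) ^ (m + j) * ((s * real j - 1) gchoose m) * (real (k choose j) * (p / s) ^ k))"
    if k: "k \<le> m" for k
  proof -
    have "fps_const ((- p) ^ k) * \<Psi> ^ k = (fps_const (- p) * \<Psi>) ^ k"
      by (simp add: power_mult_distrib fps_const_power)
    also have "fps_const (- p) * \<Psi> = fps_const (p / s) * (- B + 1)"
      unfolding \<Psi>_def by (simp add: algebra_simps flip: mult.assoc fps_const_neg)
    also have "\<dots> ^ k = fps_const ((p / s) ^ k) * (\<Sum>j\<le>k. of_nat (k choose j) * (- B) ^ j)"
      unfolding power_mult_distrib binomial_ring by (simp add: fps_const_power)
    \<comment> \<open>The added terms have vanishing binomial coefficients; summing over a square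
      allows the two sums to be exchanged.\<close>
    also have "(\<Sum>j\<le>k. of_nat (k choose j) * (- B) ^ j) = (\<Sum>j\<le>m. of_nat (k choose j) * (- B) ^ j)"
      using k by (intro sum.mono_neutral_left) auto
    finally have "fps_const ((- p) ^ k) * (fps_geo * \<Psi> ^ k) =
        fps_const ((p / s) ^ k) * (\<Sum>j\<le>m. of_nat (k choose j) * (fps_geo * (- B) ^ j))"
      by (simp add: mult.left_commute sum_distrib_left)
    also have "(\<lambda>j. fps_geo * (- B) ^ j) = (\<lambda>j. fps_const ((-1) ^ j) * fps_one_minus_powr (s * real j - 1))"
    proof
      fix j
      have "fps_geo * B ^ j = fps_one_minus_powr (s * real j - 1)"
        unfolding B_def fps_one_minus_powr_power fps_one_minus_powr_minus_one[symmetric]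
        by (simp add: mult.commute flip: fps_one_minus_powr_add)
      moreover have "(- B) ^ j = fps_const ((-1) ^ j) * B ^ j"
        by (subst power_minus) (simp flip: fps_const_power fps_const_neg)
      ultimately show "fps_geo * (- B) ^ j = fps_const ((-1) ^ j) * fps_one_minus_powr (s * real j - 1)"
        by (simp add: mult.left_commute)
    qed
    finally have "(fps_const ((- p) ^ k) * (fps_geo * \<Psi> ^ k)) $ m =
        (fps_const ((p / s) ^ k) * (\<Sum>j\<le>m. of_nat (k choose j) * (fps_const ((-1) ^ j) * fps_one_minus_powr (s * real j - 1)))) $ m"
      by simp
    then have "(- p) ^ k * (fps_geo * \<Psi> ^ k) $ m = (p / s) ^ k *
        (\<Sum>j\<le>m. of_nat (k choose j) * (fps_const ((-1) ^ j) * fps_one_minus_powr (s * real j - 1))) $ m"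
      by (simp only: fps_mult_left_const_nth)
    then show ?thesis
      by (simp add: fps_sum_nth sum_distrib_left power_add mult_ac flip: fps_of_nat)
  qed
  have "EP p (Suc m) = (\<Sum>k\<le>m. (- p) ^ k * (fps_geo * \<Psi> ^ k) $ m)"
    by (rule EP_eq_psi_sum) (use p ode \<Psi>0 in auto)
  also have "\<dots> = (\<Sum>k\<le>m. \<Sum>j\<le>m. (-1) ^ (m + j) * ((s * real j - 1) gchoose m) * (real (k choose j) * (p / s) ^ k))"
    by (intro sum.cong refl coeff) simp
  also have "\<dots> = (\<Sum>j\<le>m. \<Sum>k\<le>m. (-1) ^ (m + j) * ((s * real j - 1) gchoose m) * (real (k choose j) * (p / s) ^ k))"
    by (rule sum.swap)
  finally show ?thesis by (simp add: s_def sum_distrib_left)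
qed

section \<open>Complete Bell polynomials through set partitions\<close>

lemma sum_Pow_card:
  fixes f :: "nat \<Rightarrow> 'a :: comm_semiring_1"
  assumes "finite A"
  shows "(\<Sum>C\<in>Pow A. f (card C)) = (\<Sum>i\<le>card A. of_nat (card A choose i) * f i)"
proof -
  have "(\<Sum>C\<in>Pow A. f (card C)) = (\<Sum>i\<le>card A. \<Sum>C | C \<in> Pow A \<and> card C = i. f (card C))"
    using assms by (intro sum.group[symmetric]) (auto intro: card_mono)
  also have "\<dots> = (\<Sum>i\<le>card A. of_nat (card A choose i) * f i)"
    using n_subsets[OF assms] by (intro sum.cong refl) simp
  finally show ?thesis .
qed

text \<open>A partition of \<open>insert a A\<close> is determined by the companions
  \<open>C\<close> of \<open>a\<close> in its block and by the partition of what is left.\<close>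

lemma bij_betw_partition_on_insert:
  assumes a: "a \<notin> A"
  shows "bij_betw (\<lambda>(C, Q). insert (insert a C) Q)
           (SIGMA C:Pow A. {Q. partition_on (A - C) Q}) {P. partition_on (insert a A) P}"
  unfolding bij_betw_def
proof (intro conjI)
  show "inj_on (\<lambda>(C, Q). insert (insert a C) Q) (SIGMA C:Pow A. {Q. partition_on (A - C) Q})"
  proof (rule inj_onI, clarify)
    fix C Q D R
    assume CQ: "C \<subseteq> A" "partition_on (A - C) Q" and DR: "D \<subseteq> A" "partition_on (A - D) R"
      and eq: "insert (insert a C) Q = insert (insert a D) R"
    have nQ: "a \<notin> X" if "X \<in> Q" for X using that CQ a by (auto simp: partition_on_def)
    have nR: "a \<notin> X" if "X \<in> R" for X using that DR a by (auto simp: partition_on_def)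
    have "insert a C \<in> insert (insert a D) R" using eq by auto
    then have "insert a C = insert a D" using nR by blast
    moreover have "a \<notin> C" "a \<notin> D" using CQ DR a by auto
    ultimately have "C = D" by (simp add: insert_ident)
    \<comment> \<open>The remaining blocks are recognised as those not containing
      \<open>a\<close>.\<close>
    moreover have "Q = {X \<in> insert (insert a C) Q. a \<notin> X}" "R = {X \<in> insert (insert a D) R. a \<notin> X}"
      using nQ nR by auto
    then have "Q = R" using eq by simp
    ultimately show "C = D \<and> Q = R" by simp
  qed
  show "(\<lambda>(C, Q). insert (insert a C) Q) ` (SIGMA C:Pow A. {Q. partition_on (A - C) Q}) =
      {P. partition_on (insert a A) P}"
  proof (intro equalityI subsetI)
    fix P assume "P \<in> (\<lambda>(C, Q). insert (insert a C) Q) ` (SIGMA C:Pow A. {Q. partition_on (A - C) Q})"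
    then obtain C Q where CQ: "C \<subseteq> A" "partition_on (A - C) Q" "P = insert (insert a C) Q" by auto
    have "disjnt (insert a C) (\<Union>Q)" using CQ a by (auto simp: partition_on_def disjnt_iff)
    moreover have "insert a A - insert a C = A - C" using a by auto
    ultimately show "P \<in> {P. partition_on (insert a A) P}"
      using CQ partition_on_insert[of "insert a C" Q "insert a A"] by auto
  next
    fix P assume "P \<in> {P. partition_on (insert a A) P}"
    then have P: "partition_on (insert a A) P" by simp
    then obtain B where B: "B \<in> P" "a \<in> B" by (auto simp: partition_on_def)
    define C Q where "C = B - {a}" and "Q = P - {B}"
    have PQ: "P = insert B Q" "B = insert a C" using B by (auto simp: C_def Q_def)
    have "disjnt B (\<Union>Q)"
      using P B by (auto simp: partition_on_def Q_def disjnt_iff disjoint_def)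
    then have "partition_on (insert a A - B) Q" "B \<subseteq> insert a A"
      using P partition_on_insert[of B Q "insert a A"] PQ by auto
    moreover have "insert a A - B = A - C" "C \<subseteq> A" using a B calculation by (auto simp: C_def)
    ultimately show "P \<in> (\<lambda>(C, Q). insert (insert a C) Q) ` (SIGMA C:Pow A. {Q. partition_on (A - C) Q})"
      using PQ by (intro image_eqI[of _ _ "(C, Q)"]) auto
  qed
qed

text \<open>Splitting by the block of a fixed element, which has \<open>i\<close> companions chosen
  among \<open>n\<close>, gives the recurrence of the Bell polynomials; hence any sequence obeying
  it is the sum over partitions.\<close>

lemma sum_partition_on_eq:
  fixes x D :: "nat \<Rightarrow> 'a :: comm_semiring_1"
  assumes "finite A" and D0: "D 0 = 1"
    and D: "\<And>n. D (Suc n) = (\<Sum>i\<le>n. of_nat (n choose i) * (x (Suc i) * D (n - i)))"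
  shows "(\<Sum>P | partition_on A P. \<Prod>B\<in>P. x (card B)) = D (card A)"
  using assms(1)
proof (induction "card A" arbitrary: A rule: less_induct)
  case less
  show ?case
  proof (cases "A = {}")
    case True
    have "{P. partition_on {} P} = {{} :: 'b set set}" by (auto simp: partition_on_empty)
    then show ?thesis using True D0 by simp
  next
    case False
    then obtain a A' where A: "A = insert a A'" "a \<notin> A'" by (metis mk_disjoint_insert ex_in_conv)
    with less.prems have fin: "finite A'" by simp
    have sub: "(\<Sum>Q | partition_on (A' - C) Q. \<Prod>B\<in>insert (insert a C) Q. x (card B)) =
        x (Suc (card C)) * D (card A' - card C)" if C: "C \<subseteq> A'" for C
    proof -
      have "(\<Sum>Q | partition_on (A' - C) Q. \<Prod>B\<in>insert (insert a C) Q. x (card B)) =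
          (\<Sum>Q | partition_on (A' - C) Q. x (Suc (card C)) * (\<Prod>B\<in>Q. x (card B)))"
      proof (intro sum.cong refl, clarify)
        fix Q assume Q: "partition_on (A' - C) Q"
        have "finite Q" using finite_elements[OF _ Q] fin by simp
        moreover have "insert a C \<notin> Q" using Q A by (auto simp: partition_on_def)
        moreover have "card (insert a C) = Suc (card C)"
          using C A fin finite_subset by (subst card_insert_disjoint) auto
        ultimately show "(\<Prod>B\<in>insert (insert a C) Q. x (card B)) = x (Suc (card C)) * (\<Prod>B\<in>Q. x (card B))"
          by simp
      qed
      also have "\<dots> = x (Suc (card C)) * (\<Sum>Q | partition_on (A' - C) Q. \<Prod>B\<in>Q. x (card B))"
        by (rule sum_distrib_left[symmetric])
      also have "(\<Sum>Q | partition_on (A' - C) Q. \<Prod>B\<in>Q. x (card B)) = D (card (A' - C))"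
      proof (rule less.hyps)
        have "card (A' - C) \<le> card A'" using fin by (intro card_mono) auto
        then show "card (A' - C) < card A" using A fin by simp
      qed (use fin in simp)
      also have "card (A' - C) = card A' - card C"
        using C fin finite_subset by (intro card_Diff_subset) auto
      finally show ?thesis .
    qed
    have "(\<Sum>P | partition_on A P. \<Prod>B\<in>P. x (card B)) =
        (\<Sum>(C, Q)\<in>(SIGMA C:Pow A'. {Q. partition_on (A' - C) Q}). \<Prod>B\<in>insert (insert a C) Q. x (card B))"
      unfolding A(1)
      by (subst sum.reindex_bij_betw[OF bij_betw_partition_on_insert[OF A(2)], symmetric])
         (simp add: case_prod_unfold)
    also have "\<dots> = (\<Sum>C\<in>Pow A'. \<Sum>Q | partition_on (A' - C) Q. \<Prod>B\<in>insert (insert a C) Q. x (card B))"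
      using fin by (intro sum.Sigma[symmetric]) (auto intro: finitely_many_partition_on)
    also have "\<dots> = (\<Sum>C\<in>Pow A'. x (Suc (card C)) * D (card A' - card C))"
      using sub by (intro sum.cong) auto
    also have "\<dots> = D (Suc (card A'))"
      unfolding D using sum_Pow_card[OF fin, of "\<lambda>i. x (Suc i) * D (card A' - i)"] by simp
    finally show ?thesis using A fin by simp
  qed
qed

text \<open>Bell polynomials are the exponential coefficients of
  \<open>exp (\<Sum> x_i z^i / i!)\<close>. The exponential is characterised by its logarithmic
  derivative \<open>X\<close>, and comparing coefficients in \<open>F' = X F\<close> is the
  partition recurrence.\<close>

lemma complete_bell_eq_coeff:
  fixes F X :: "real fps"
  assumes "F $ 0 = 1" "fps_deriv F = X * F" "\<And>i. x (Suc i) = fact i * X $ i"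
  shows "complete_bell k x = fact k * F $ k"
proof -
  have "complete_bell k x = (\<lambda>k. fact k * F $ k) (card {1..k})"
    unfolding complete_bell_def
  proof (rule sum_partition_on_eq)
    fix n
    have "fact (Suc n) * F $ Suc n = fact n * fps_deriv F $ n" by (simp add: mult_ac)
    also have "\<dots> = (\<Sum>i\<le>n. fact n * (X $ i * F $ (n - i)))"
      unfolding assms(2) fps_mult_nth by (simp add: sum_distrib_left atMost_atLeast0)
    also have "\<dots> = (\<Sum>i\<le>n. real (n choose i) * (x (Suc i) * (fact (n - i) * F $ (n - i))))"
      by (intro sum.cong refl) (simp add: assms(3) binomial_fact)
    finally show "fact (Suc n) * F $ Suc n =
      (\<Sum>i\<le>n. real (n choose i) * (x (Suc i) * (fact (n - i) * F $ (n - i))))" .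
  qed (simp_all add: assms)
  then show ?thesis by simp
qed

section \<open>Powers of the logarithm, harmonic numbers and the exact formula for
  \<open>p = 1/2\<close>\<close>

definition fps_log :: "real fps" where
  "fps_log = Abs_fps (\<lambda>n. - 1 / real n)"

text \<open>Division by zero yields the right constant term of \<open>log (1 - z)\<close>.\<close>

lemma fps_log_0 [simp]: "fps_log $ 0 = 0"
  by (simp add: fps_log_def)

lemma fps_log_deriv: "(1 - fps_X) * fps_deriv fps_log = - 1"
proof (rule fps_ext)
  fix n show "((1 - fps_X) * fps_deriv fps_log) $ n = (- 1 :: real fps) $ n"
    by (cases n) (simp_all add: fps_log_def ring_distribs del: of_nat_Suc)
qed

text \<open>For \<open>T_k = log (1 - z)^k / (1 - z)\<close>, differentiating and multiplying by
  \<open>1 - z\<close> gives \<open>(1 - z) T_k' = T_k - k T_(k-1)\<close>. For \<open>k = 0\<close>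
  the truncated \<open>k - 1\<close> is harmless because of the factor \<open>k\<close>.\<close>

lemma fps_geo_log_power_rec:
  "(fps_geo * fps_log ^ k) $ Suc N = (fps_geo * fps_log ^ k) $ N
     - real k / real (Suc N) * (fps_geo * fps_log ^ (k - 1)) $ N"
proof -
  let ?T = "\<lambda>k. fps_geo * fps_log ^ k"
  have "fps_deriv (?T k) = fps_geo * ?T k + fps_geo * (of_nat k * fps_log ^ (k - 1) * fps_deriv fps_log)"
    by (simp add: fps_deriv_power fps_deriv_fps_geo fps_of_nat algebra_simps)
  then have "(1 - fps_X) * fps_deriv (?T k) =
      ((1 - fps_X) * fps_geo) * ?T k + of_nat k * ?T (k - 1) * ((1 - fps_X) * fps_deriv fps_log)"
    by (simp only: distrib_left mult_ac)
  then have "(1 - fps_X) * fps_deriv (?T k) = ?T k - of_nat k * ?T (k - 1)"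
    unfolding fps_geo_mult fps_log_deriv by simp
  moreover have "((1 - fps_X) * fps_deriv F) $ N = real (Suc N) * F $ Suc N - real N * F $ N"
    for F :: "real fps"
    by (cases N) (simp_all add: left_diff_distrib)
  ultimately have "real (Suc N) * ?T k $ Suc N - real N * ?T k $ N = (?T k - of_nat k * ?T (k - 1)) $ N"
    by metis
  then have "real (Suc N) * ?T k $ Suc N - real N * ?T k $ N = ?T k $ N - real k * ?T (k - 1) $ N"
    by (simp flip: fps_of_nat)
  then have "real (Suc N) * ?T k $ Suc N = real (Suc N) * ?T k $ N - real k * ?T (k - 1) $ N"
    by (simp add: algebra_simps)
  then show ?thesis by (simp add: field_simps del: of_nat_Suc)
qed

text \<open>In a second variable \<open>u\<close>, the series \<open>F N\<close> is the coefficient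
  of \<open>z^N\<close> in \<open>exp (u log (1 - z)) / (1 - z) = (1 - z)^(u - 1)\<close>, which is
  the product of \<open>1 - u / j\<close> over \<open>j = 1..N\<close>. Its logarithmic derivative
  \<open>H N\<close> has the negated harmonic numbers as coefficients.\<close>

lemma complete_bell_harmonic:
  "complete_bell k (\<lambda>m. - fact (m - 1) * gen_harmonic m N) = (fps_geo * fps_log ^ k) $ N"
proof -
  define F where "F = (\<lambda>N. Abs_fps (\<lambda>k. (fps_geo * fps_log ^ k) $ N / fact k))"
  define H where "H = (\<lambda>N. Abs_fps (\<lambda>i. - gen_harmonic (Suc i) N))"
  have F0: "F N $ 0 = 1" for N
    by (simp add: F_def)
  have F_Suc: "F (Suc N) = F N * (1 - fps_const (1 / real (Suc N)) * fps_X)" for N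
  proof (rule fps_ext)
    fix k
    have "(fps_geo * fps_log ^ k) $ Suc N / fact k = (fps_geo * fps_log ^ k) $ N / fact k
        - (if k = 0 then 0 else (fps_geo * fps_log ^ (k - 1)) $ N / fact (k - 1) / real (Suc N))"
      unfolding fps_geo_log_power_rec[of k N] by (cases k) (simp_all add: field_simps del: of_nat_Suc)
    then show "F (Suc N) $ k = (F N * (1 - fps_const (1 / real (Suc N)) * fps_X)) $ k"
      by (simp add: F_def right_diff_distrib mult.left_commute[of _ "fps_const _"] del: of_nat_Suc)
  qed
  have ode: "fps_deriv (F N) = H N * F N" for N
  proof (induction N)
    case 0
    have "F 0 = 1"
    proof (rule fps_ext)
      fix k show "F 0 $ k = (1 :: real fps) $ k" by (cases k) (simp_all add: F_def)
    qed
    moreover have "H 0 = 0" by (simp add: H_def gen_harmonic_def fps_eq_iff)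
    ultimately show ?case by simp
  next
    case (Suc N)
    define c where "c = 1 / real (Suc N)"
    \<comment> \<open>The series \<open>c / (1 - c u)\<close>, minus the logarithmic derivative of
      the new factor \<open>1 - c u\<close>.\<close>
    define g where "g = Abs_fps (\<lambda>i. c ^ Suc i)"
    have H_Suc: "H (Suc N) = H N - g"
      by (simp add: H_def g_def c_def gen_harmonic_def fps_eq_iff power_divide del: of_nat_Suc)
    have g: "g * (1 - fps_const c * fps_X) = fps_const c"
    proof (rule fps_ext)
      fix k show "(g * (1 - fps_const c * fps_X)) $ k = fps_const c $ k"
        by (cases k) (simp_all add: g_def right_diff_distrib mult.left_commute[of _ "fps_const _"])
    qed
    have "fps_deriv (F (Suc N)) = H N * F N * (1 - fps_const c * fps_X) - F N * fps_const c"
      unfolding F_Suc c_def[symmetric] by (simp add: Suc.IH algebra_simps)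
    also have "\<dots> = H N * F N * (1 - fps_const c * fps_X) - F N * (g * (1 - fps_const c * fps_X))"
      by (simp only: g)
    also have "\<dots> = (H N - g) * (F N * (1 - fps_const c * fps_X))"
      by (simp add: algebra_simps)
    finally show ?case unfolding H_Suc F_Suc c_def .
  qed
  have "complete_bell k (\<lambda>m. - fact (m - 1) * gen_harmonic m N) = fact k * F N $ k"
    by (rule complete_bell_eq_coeff[OF F0 ode]) (simp add: H_def)
  then show ?thesis by (simp add: F_def)
qed

lemma EP_half:
  "EP (1/2) (Suc m) = (\<Sum>k\<le>m. (-1) ^ k / 2 ^ k * complete_bell k (\<lambda>j. - fact (j - 1) * gen_harmonic j m))"
proof -
  have "EP (1/2) (Suc m) = (\<Sum>k\<le>m. (- (1/2)) ^ k * (fps_geo * fps_log ^ k) $ m)"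
    by (rule EP_eq_psi_sum) (simp_all add: fps_log_deriv)
  moreover have "(- (1/2)) ^ k = (-1) ^ k / (2 ^ k :: real)" for k
    by (subst power_minus) (simp add: power_divide)
  ultimately show ?thesis unfolding complete_bell_harmonic by simp
qed

section \<open>Transfer of bounds to coefficients\<close>

definition slit_plane :: "complex set" where
  "slit_plane = {z. 1 - z \<notin> \<real>\<^sub>\<le>\<^sub>0}"

text \<open>The sector where the argument of \<open>1 - z\<close> is at most \<open>2 pi / 3\<close>
  in modulus, without its vertex. Being closed up to the vertex, it meets annuli about
  \<open>1\<close> in compact sets.\<close>

definition wide_sector :: "complex set" where
  "wide_sector = {z. z \<noteq> 1 \<and> Re (1 - z) \<ge> - norm (1 - z) / 2}"

lemma open_slit_plane: "open slit_plane"
proof -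
  have "slit_plane = (\<lambda>z. 1 - z) -` (- \<real>\<^sub>\<le>\<^sub>0)"
    by (auto simp: slit_plane_def)
  also have "open \<dots>"
    by (intro open_vimage continuous_intros) (simp add: open_Compl)
  finally show ?thesis .
qed

lemma wide_sector_subset: "wide_sector \<subseteq> slit_plane"
proof
  fix z assume z: "z \<in> wide_sector"
  show "z \<in> slit_plane"
  proof (rule ccontr)
    assume "z \<notin> slit_plane"
    then have *: "Re (1 - z) \<le> 0" "Im (1 - z) = 0"
      by (auto simp: slit_plane_def complex_nonpos_Reals_iff)
    then have "norm (1 - z) = - Re (1 - z)" by (simp add: cmod_eq_Re)
    moreover have "Re (1 - z) \<ge> - norm (1 - z) / 2" using z by (simp add: wide_sector_def)
    ultimately have "Re (1 - z) = 0" using * by linarith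
    with * have "1 - z = 0" by (simp add: complex_eq_iff)
    with z show False by (simp add: wide_sector_def)
  qed
qed

lemma Re_one_minus_pos: "norm (z :: complex) < 1 \<Longrightarrow> Re (1 - z) > 0"
  using complex_Re_le_cmod[of z] by simp

text \<open>The opening of the sector fits the radius: \<open>Re (1 - z) > 0\<close> drops by at
  most \<open>|1 - z| / 3\<close>, and this is at most \<open>|1 - w| / 2\<close> because
  \<open>|1 - w| \<ge> (2/3) |1 - z|\<close>.\<close>

lemma cball_subset_wide_sector:
  assumes "norm z < 1" "w \<in> cball z (norm (1 - z) / 3)"
  shows "w \<in> wide_sector" "norm (1 - w) \<ge> 2 / 3 * norm (1 - z)" "norm (1 - w) \<le> 4 / 3 * norm (1 - z)"
proof -
  have d: "norm ((1 - z) - (1 - w)) \<le> norm (1 - z) / 3"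
    using assms(2) by (simp add: dist_norm norm_minus_commute)
  have pos: "norm (1 - z) > 0" using assms(1) by auto
  show 1: "norm (1 - w) \<ge> 2 / 3 * norm (1 - z)"
    using norm_triangle_ineq2[of "1 - z" "1 - w"] d by simp
  show "norm (1 - w) \<le> 4 / 3 * norm (1 - z)"
    using norm_triangle_ineq2[of "1 - w" "1 - z"] d norm_minus_commute[of "1 - z" "1 - w"] by simp
  have "Re ((1 - z) - (1 - w)) \<le> norm (1 - z) / 3"
    using complex_Re_le_cmod[of "(1 - z) - (1 - w)"] d by linarith
  then have "Re (1 - w) \<ge> - norm (1 - z) / 3" using Re_one_minus_pos[OF assms(1)] by simp
  moreover have "w \<noteq> 1" using 1 pos by auto
  ultimately show "w \<in> wide_sector" using 1 by (auto simp: wide_sector_def)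
qed

lemma ball_subset_slit_plane: "norm z < 1 \<Longrightarrow> z \<in> slit_plane"
  using cball_subset_wide_sector(1)[of z z] wide_sector_subset by auto

text \<open>On \<open>|u| = r\<close> the conjugate of \<open>u\<close> is \<open>r^2 / u\<close>,
  so \<open>|1 - u|^2 = (1 - u) (u - r^2) / u\<close>. The integral is thus Cauchy's formula for
  \<open>1 / (1 - u)\<close> at the point \<open>r^2\<close> inside the circle.\<close>

lemma poisson_integral_circle:
  assumes "0 < r" "r < 1"
  shows "((\<lambda>t. 1 / (norm (1 - circlepath 0 r t))\<^sup>2) has_integral 1 / (1 - r\<^sup>2)) {0..1}"
proof -
  have r2: "r\<^sup>2 < r" using assms by (simp add: power2_eq_square)
  let ?f = "\<lambda>u::complex. 1 / (1 - u)"
  have "((\<lambda>u. ?f u / (u - of_real (r\<^sup>2))) has_contour_integral (2 * of_real pi * \<i> * ?f (of_real (r\<^sup>2)))) (circlepath 0 r)"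
  proof (rule Cauchy_integral_circlepath_simple)
    show "?f holomorphic_on cball 0 r"
      using assms by (intro holomorphic_intros) auto
    show "norm (of_real (r\<^sup>2) - 0 :: complex) < r"
      using r2 by (simp add: norm_power)
  qed
  then have 1: "((\<lambda>t. ?f (circlepath 0 r t) / (circlepath 0 r t - of_real (r\<^sup>2)) *
      vector_derivative (circlepath 0 r) (at t)) has_integral (2 * of_real pi * \<i> * ?f (of_real (r\<^sup>2)))) {0..1}"
    by (simp only: has_contour_integral)
  have eq: "?f (circlepath 0 r t) / (circlepath 0 r t - of_real (r\<^sup>2)) *
      vector_derivative (circlepath 0 r) (at t) = 2 * of_real pi * \<i> * of_real (1 / (norm (1 - circlepath 0 r t))\<^sup>2)" for t
  proof -
    define u where "u = circlepath 0 r t"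
    have u: "u = of_real r * exp (2 * of_real pi * \<i> * of_real t)" by (simp add: u_def circlepath)
    have nu: "norm u = r" using assms by (simp add: u norm_mult)
    have "u \<noteq> 0" "u \<noteq> 1" using nu assms by auto
    have "of_real (r\<^sup>2) = u * cnj u" using nu by (simp add: complex_norm_square [symmetric])
    then have 1: "u - of_real (r\<^sup>2) = u * cnj (1 - u)" by (simp add: algebra_simps)
    have 2: "vector_derivative (circlepath 0 r) (at t) = 2 * of_real pi * \<i> * u"
      by (simp add: vector_derivative_circlepath u)
    have 3: "complex_of_real (1 / (norm (1 - u))\<^sup>2) = 1 / ((1 - u) * cnj (1 - u))"
      unfolding of_real_divide complex_norm_square by simp
    have "1 / w / (u * v) * (c * u) = c * (1 / (w * v))" for w v c :: complex
      using \<open>u \<noteq> 0\<close> by simp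
    then show ?thesis unfolding u_def[symmetric] 1 2 3 .
  qed
  have "((\<lambda>t. 1 / (2 * of_real pi * \<i>) * (2 * of_real pi * \<i> * complex_of_real (1 / (norm (1 - circlepath 0 r t))\<^sup>2)))
      has_integral 1 / (2 * of_real pi * \<i>) * (2 * of_real pi * \<i> * ?f (of_real (r\<^sup>2)))) {0..1}"
    using 1 unfolding eq by (rule has_integral_mult_right)
  then have "((\<lambda>t. complex_of_real (1 / (norm (1 - circlepath 0 r t))\<^sup>2)) has_integral of_real (1 / (1 - r\<^sup>2))) {0..1}"
    by simp
  from has_integral_linear[OF this bounded_linear_Re] show ?thesis
    by (simp add: o_def)
qed

lemma contour_integral_circle_poisson_bound:
  assumes i: "(f has_contour_integral i) (circlepath 0 r)" and r: "0 < r" "r < 1"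
    and B: "\<And>u. norm u = r \<Longrightarrow> norm (f u) \<le> B / (norm (1 - u))\<^sup>2"
  shows "norm i \<le> 2 * pi * r * (B / (1 - r\<^sup>2))"
proof -
  have i': "((\<lambda>t. f (circlepath 0 r t) * vector_derivative (circlepath 0 r) (at t)) has_integral i) {0..1}"
    using i by (simp only: has_contour_integral)
  have P: "((\<lambda>t. 2 * pi * r * B * (1 / (norm (1 - circlepath 0 r t))\<^sup>2)) has_integral
      2 * pi * r * B * (1 / (1 - r\<^sup>2))) {0..1}"
    by (intro has_integral_mult_right poisson_integral_circle r)
  have "norm (integral {0..1} (\<lambda>t. f (circlepath 0 r t) * vector_derivative (circlepath 0 r) (at t))) \<le>
      integral {0..1} (\<lambda>t. 2 * pi * r * B * (1 / (norm (1 - circlepath 0 r t))\<^sup>2))"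
  proof (rule integral_norm_bound_integral)
    fix t :: real
    have "norm (circlepath 0 r t) = r" using r by (simp add: circlepath norm_mult)
    then have "norm (f (circlepath 0 r t)) \<le> B / (norm (1 - circlepath 0 r t))\<^sup>2" by (rule B)
    moreover have "norm (vector_derivative (circlepath 0 r) (at t)) = 2 * pi * r"
      using r by (simp add: vector_derivative_circlepath norm_mult)
    ultimately show "norm (f (circlepath 0 r t) * vector_derivative (circlepath 0 r) (at t)) \<le>
        2 * pi * r * B * (1 / (norm (1 - circlepath 0 r t))\<^sup>2)"
      using mult_right_mono[of "norm (f (circlepath 0 r t))" "B / (norm (1 - circlepath 0 r t))\<^sup>2" "2 * pi * r"] r
      by (simp add: norm_mult mult_ac)
  qed (use i' P in \<open>auto simp: has_integral_iff\<close>)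
  then show ?thesis using i' P by (simp add: has_integral_iff)
qed

text \<open>The ratio \<open>y / x\<close> lies between \<open>2/3\<close> and \<open>4/3\<close>
  and the exponent between \<open>-1\<close> and \<open>1\<close>, so the power grows at most by
  \<open>3/2\<close>.\<close>

lemma powr_neg_bound_near:
  fixes x y a :: real
  assumes "0 < x" "2 / 3 * x \<le> y" "y \<le> 4 / 3 * x" "- 1 \<le> a" "a \<le> 1"
  shows "y powr (- a) \<le> 2 * x powr (- a)"
proof -
  define q where "q = y / x"
  have q: "2 / 3 \<le> q" "q \<le> 4 / 3" and y: "y = q * x" using assms by (auto simp: q_def field_simps)
  have "q powr (- a) \<le> 2"
  proof (cases "a \<ge> 0")
    case True
    then have "q powr (- a) \<le> (2 / 3) powr (- a)" using q by (intro powr_mono2') auto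
    also have "\<dots> = (3 / 2) powr a" by (simp add: powr_minus_divide powr_divide)
    also have "\<dots> \<le> (3 / 2) powr 1" using assms by (intro powr_mono) auto
    finally show ?thesis by simp
  next
    case False
    then have "q powr (- a) \<le> (4 / 3) powr (- a)" using q by (intro powr_mono2) auto
    also have "\<dots> \<le> (4 / 3) powr 1" using assms by (intro powr_mono) auto
    finally show ?thesis by simp
  qed
  then show ?thesis unfolding y using q assms by (subst powr_mult) (auto intro: mult_right_mono)
qed

text \<open>The third derivative makes the singularity at \<open>1\<close> strong enough for the Poisson kernel
  to dominate it on the circle of radius \<open>1 - 1/n\<close>, so no contour other than circles is needed.\<close>

lemma coeff_transfer_bound:
  fixes g :: "complex \<Rightarrow> complex" and a M :: real and n :: nat
  assumes a: "- 1 < a" "a \<le> 1" and n: "n \<ge> 3"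
    and hol: "g holomorphic_on slit_plane"
    and bound: "\<And>z. z \<in> wide_sector \<Longrightarrow> 1 / (2 * real n) \<le> norm (1 - z) \<Longrightarrow> norm (1 - z) \<le> 3 \<Longrightarrow>
                  norm (g z) \<le> M * norm (1 - z) powr (- a)"
  shows "norm ((deriv ^^ n) g 0 / fact n) \<le> 5000 * M * real n powr (a - 1)"
proof -
  define r where "r = 1 - 1 / real n"
  have r: "0 < r" "r < 1" using n by (auto simp: r_def)
  define k where "k = n - 3"
  have nk: "n = k + 3" using n by (simp add: k_def)
  have M: "M \<ge> 0"
  proof -
    have "0 \<in> wide_sector" by (simp add: wide_sector_def)
    then have "norm (g 0) \<le> M * norm (1 - 0 :: complex) powr (- a)"
      using n by (intro bound) auto
    then show ?thesis using norm_ge_zero[of "g 0"] by (simp add: order_trans del: norm_ge_zero)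
  qed
  let ?g3 = "(deriv ^^ 3) g"
  \<comment> \<open>\<open>324 = 3! * 2 * 3^3\<close>: Cauchy's factor, the variation of the power
    over the disc, and the cube of the radius \<open>|1 - z| / 3\<close>.\<close>
  have g3: "norm (?g3 z) \<le> 324 * M * real n powr (a + 1) / (norm (1 - z))\<^sup>2" if z: "norm z = r" for z
  proof -
    define x where "x = norm (1 - z)"
    have z1: "norm z < 1" using z r by simp
    have x: "1 / real n \<le> x"
      using norm_triangle_ineq2[of 1 z] z by (simp add: x_def r_def)
    have x2: "x \<le> 2" using norm_triangle_ineq4[of 1 z] z1 unfolding x_def norm_one by linarith
    have "1 / real n > 0" using n by simp
    with x have x0: "x > 0" by linarith
    have "norm (?g3 z) \<le> fact 3 * (2 * M * x powr (- a)) / (x / 3) ^ 3"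
    proof (rule Cauchy_inequality)
      have sub: "cball z (x / 3) \<subseteq> slit_plane"
        using cball_subset_wide_sector(1)[OF z1] wide_sector_subset by (auto simp: x_def)
      show "g holomorphic_on ball z (x / 3)"
        using hol sub ball_subset_cball by (meson holomorphic_on_subset order_trans)
      show "continuous_on (cball z (x / 3)) g"
        using hol sub by (meson holomorphic_on_imp_continuous_on holomorphic_on_subset)
      show "0 < x / 3" using x0 by simp
      fix w assume "norm (z - w) = x / 3"
      then have w: "w \<in> cball z (norm (1 - z) / 3)" by (simp add: dist_norm x_def)
      note ws = cball_subset_wide_sector[OF z1 w]
      have "norm (g w) \<le> M * norm (1 - w) powr (- a)"
      proof (rule bound[OF ws(1)])
        \<comment> \<open>The circle keeps distance \<open>1/n\<close> from \<open>1\<close> and the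
          discs about its points keep \<open>2/(3n)\<close>, so the hypothesis on \<open>g\<close>
          covers them.\<close>
        have "1 / (2 * real n) \<le> 2 / 3 * (1 / real n)" using n by (simp add: field_simps)
        then show "1 / (2 * real n) \<le> norm (1 - w)" using ws(2) x unfolding x_def by linarith
        show "norm (1 - w) \<le> 3" using ws(3) x2 unfolding x_def by linarith
      qed
      also have "\<dots> \<le> M * (2 * x powr (- a))"
        using ws x0 a M unfolding x_def by (intro mult_left_mono powr_neg_bound_near) auto
      finally show "norm (g w) \<le> 2 * M * x powr (- a)" by simp
    qed
    also have "\<dots> = 324 * M * (x powr (- a) / x ^ 3)"
      by (simp add: fact_numeral power_divide)
    also have "x powr (- a) / x ^ 3 = x powr (- (a + 1)) / x\<^sup>2"
    proof -
      have "x powr (- (a + 1)) = x powr (- a) / x" using x0 powr_diff[of x "- a" 1] by simp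
      then show ?thesis by (simp add: power3_eq_cube power2_eq_square)
    qed
    \<comment> \<open>Here \<open>a > -1\<close> enters: this part of the power is largest at
      distance \<open>1/n\<close>, and the remaining \<open>x^(-2)\<close> is the Poisson
      kernel.\<close>
    also have "x powr (- (a + 1)) \<le> (1 / real n) powr (- (a + 1))"
      using x n a by (intro powr_mono2') auto
    also have "(1 / real n) powr (- (a + 1)) = real n powr (a + 1)"
      by (subst powr_minus, subst powr_divide) auto
    finally show ?thesis using M by (simp add: x_def mult_left_mono divide_right_mono)
  qed
  have hol3: "?g3 holomorphic_on slit_plane"
    by (intro holomorphic_higher_deriv hol open_slit_plane)
  have sub: "cball 0 r \<subseteq> slit_plane" using r ball_subset_slit_plane by auto
  have "((\<lambda>u. ?g3 u / (u - 0) ^ Suc k) has_contour_integral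
      ((2 * pi * \<i>) / fact k * (deriv ^^ k) ?g3 0)) (circlepath 0 r)"
  proof (rule Cauchy_has_contour_integral_higher_derivative_circlepath)
    show "continuous_on (cball 0 r) ?g3"
      using hol3 sub by (meson holomorphic_on_imp_continuous_on holomorphic_on_subset)
    show "?g3 holomorphic_on ball 0 r"
      using hol3 sub ball_subset_cball by (meson holomorphic_on_subset order_trans)
  qed (use r in auto)
  moreover have "(deriv ^^ k) ?g3 0 = (deriv ^^ n) g 0"
    unfolding nk funpow_add by simp
  ultimately have "((\<lambda>u. ?g3 u / u ^ Suc k) has_contour_integral
      ((2 * pi * \<i>) / fact k * (deriv ^^ n) g 0)) (circlepath 0 r)" by simp
  then have "norm ((2 * pi * \<i>) / fact k * (deriv ^^ n) g 0) \<le>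
      2 * pi * r * (324 * M * real n powr (a + 1) / r ^ Suc k / (1 - r\<^sup>2))"
  proof (rule contour_integral_circle_poisson_bound[OF _ r])
    fix u :: complex assume u: "norm u = r"
    show "norm (?g3 u / u ^ Suc k) \<le> 324 * M * real n powr (a + 1) / r ^ Suc k / (norm (1 - u))\<^sup>2"
      using divide_right_mono[OF g3[OF u], of "r ^ Suc k"] r u
      by (simp add: norm_divide norm_power norm_mult mult_ac)
  qed
  then have "norm ((deriv ^^ n) g 0) / fact k * (2 * pi) \<le> (324 * M * real n powr (a + 1) / r ^ k / (1 - r\<^sup>2)) * (2 * pi)"
    using r by (simp add: norm_mult norm_divide mult_ac)
  then have "norm ((deriv ^^ n) g 0) / fact k \<le> 324 * M * real n powr (a + 1) * ((1 / r ^ k) * (1 / (1 - r\<^sup>2)))"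
    by (subst (asm) mult_le_cancel_right_pos) auto
  also have "\<dots> \<le> 324 * M * real n powr (a + 1) * (3 * real n)"
  proof (intro mult_left_mono mult_mono)
    \<comment> \<open>There are fewer than \<open>n - 1\<close> factors
      \<open>1 + 1 / (n - 1)\<close>, so their product stays below \<open>e\<close>.\<close>
    have "1 / r = 1 + 1 / (real n - 1)" using n by (simp add: r_def field_simps)
    also have "\<dots> \<le> exp (1 / (real n - 1))" by (rule exp_ge_add_one_self)
    finally have "(1 / r) ^ k \<le> exp (1 / (real n - 1)) ^ k" using r by (intro power_mono) auto
    also have "\<dots> = exp (real k / (real n - 1))" by (simp flip: exp_of_nat_mult)
    also have "\<dots> \<le> exp 1" using nk by simp
    also have "\<dots> \<le> 3" by (rule exp_le)
    finally show "1 / r ^ k \<le> 3" by (simp add: power_divide)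
    have "1 - r\<^sup>2 \<ge> 1 / real n"
    proof -
      have "r\<^sup>2 \<le> r" using r by (simp add: power2_eq_square)
      then show ?thesis by (simp add: r_def)
    qed
    then show "1 / (1 - r\<^sup>2) \<le> real n"
      using frac_le[of 1 1 "1 / real n" "1 - r\<^sup>2"] n by simp
    show "0 \<le> 1 / (1 - r\<^sup>2)" using r by (simp add: power_le_one)
  qed (use M in auto)
  finally have 1: "norm ((deriv ^^ n) g 0) / fact k \<le> 972 * M * (real n powr (a + 1) * real n)" by simp
  define d where "d = real n * (real n - 1) * (real n - 2)"
  have d: "d > 0" using n by (simp add: d_def)
  have fact_n: "fact n = d * fact k"
    unfolding nk d_def by (simp add: numeral_3_eq_3 algebra_simps)
  \<comment> \<open>Passing from \<open>(n - 3)!\<close> to \<open>n!\<close> regains the three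
    powers of \<open>n\<close> lost by differentiating. The ratio is worst at \<open>n = 3\<close>,
    where \<open>27 \<le> 5 * 6\<close>.\<close>
  have d_ge: "real n ^ 3 \<le> 5 * d"
  proof -
    have "5 * ((real n - 1) * (real n - 2)) - (real n)\<^sup>2 = 4 * (real n)\<^sup>2 - 15 * real n + 10"
      by (simp add: algebra_simps power2_eq_square)
    also have "\<dots> = (real n - 3) * (4 * real n - 3) + 1" by (simp add: algebra_simps power2_eq_square)
    also have "\<dots> \<ge> 0" using n by (intro add_nonneg_nonneg mult_nonneg_nonneg) auto
    finally have "real n * (real n)\<^sup>2 \<le> real n * (5 * ((real n - 1) * (real n - 2)))"
      by (intro mult_left_mono) auto
    then show ?thesis by (simp add: d_def power3_eq_cube power2_eq_square mult_ac)
  qed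
  have "norm ((deriv ^^ n) g 0 / fact n) = norm ((deriv ^^ n) g 0) / fact k / d"
    unfolding norm_divide norm_fact fact_n by simp
  also have "\<dots> \<le> 972 * M * (real n powr (a + 1) * real n) / d"
    using 1 d by (intro divide_right_mono) auto
  also have "\<dots> = 972 * M * (real n powr (a - 1) * real n ^ 3) / d"
  proof -
    have "real n powr (a + 1) * real n = real n powr (a + 1 + 1)"
      using n by (subst powr_add) simp
    also have "a + 1 + 1 = (a - 1) + 3" by simp
    also have "real n powr ((a - 1) + 3) = real n powr (a - 1) * real n ^ 3"
      using n by (subst powr_add) simp
    finally show ?thesis by simp
  qed
  also have "\<dots> \<le> 972 * M * (real n powr (a - 1) * (5 * d)) / d"
    using d d_ge M by (intro divide_right_mono mult_left_mono) auto
  also have "\<dots> = 4860 * M * real n powr (a - 1)" using d by simp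
  also have "\<dots> \<le> 5000 * M * real n powr (a - 1)" using M by (intro mult_right_mono) auto
  finally show ?thesis .
qed

section \<open>The generating function on the slit plane\<close>

definition psi :: "real \<Rightarrow> complex \<Rightarrow> complex" where
  "psi p z = (if p = 1/2 then Ln (1 - z)
              else ((1 - z) powr of_real (2 * p - 1) - 1) / of_real (2 * p - 1))"

definition gf_denom :: "real \<Rightarrow> complex \<Rightarrow> complex" where
  "gf_denom p z = (1 - z) * (1 + of_real p * psi p z)"

lemma slit_plane_not_1: "z \<in> slit_plane \<Longrightarrow> z \<noteq> 1"
  by (auto simp: slit_plane_def)

lemma zero_in_slit_plane: "0 \<in> slit_plane"
  by (rule ball_subset_slit_plane) simp

lemma psi_0 [simp]: "psi p 0 = 0"
  unfolding psi_def by simp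

text \<open>One differential equation covers both branches of the definition, so holomorphy, the
  residue at the pole and the link with the formal series need no case distinction.\<close>

lemma psi_has_field_derivative:
  assumes z: "z \<in> slit_plane"
  shows "(psi p has_field_derivative (- (1 + of_real (2 * p - 1) * psi p z) / (1 - z))) (at z)"
proof (cases "p = 1/2")
  case True
  have "((\<lambda>z. Ln (1 - z)) has_field_derivative (inverse (1 - z) * (0 - 1))) (at z)"
    using z by (intro derivative_intros DERIV_chain2[OF has_field_derivative_Ln]) (simp add: slit_plane_def)
  moreover have "psi p = (\<lambda>z. Ln (1 - z))" using True by (simp add: psi_def fun_eq_iff)
  moreover have "inverse (1 - z) * (0 - 1) = - (1 + of_real (2 * p - 1) * psi p z) / (1 - z)"
    using True by (simp add: field_simps)
  ultimately show ?thesis by metis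
next
  case False
  define s where "s = complex_of_real (2 * p - 1)"
  have s: "s \<noteq> 0"
    unfolding s_def of_real_eq_0_iff using False by simp
  have eq: "psi p = (\<lambda>z. ((1 - z) powr s - 1) / s)" using False by (simp add: psi_def s_def fun_eq_iff)
  have nz: "1 - z \<noteq> 0" using slit_plane_not_1[OF z] by simp
  have "((\<lambda>z. (1 - z) powr s) has_field_derivative (s * (1 - z) powr (s - 1) * (0 - 1))) (at z)"
    using z by (intro derivative_intros DERIV_chain2[OF has_field_derivative_powr]) (simp add: slit_plane_def)
  then have "(psi p has_field_derivative ((s * (1 - z) powr (s - 1) * (0 - 1) - 0) / s)) (at z)"
    unfolding eq by (intro DERIV_cdivide DERIV_diff DERIV_const)
  moreover have "(s * (1 - z) powr (s - 1) * (0 - 1) - 0) / s = - (1 + of_real (2 * p - 1) * psi p z) / (1 - z)"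
  proof -
    have 1: "(1 - z) powr (s - 1) = (1 - z) powr s / (1 - z)"
      using nz by (simp add: powr_diff)
    have 2: "1 + s * psi p z = (1 - z) powr s"
      unfolding eq using s by simp
    show ?thesis unfolding s_def[symmetric] 1 2 using s by simp
  qed
  ultimately show ?thesis by metis
qed

lemma psi_holomorphic: "psi p holomorphic_on slit_plane"
  unfolding holomorphic_on_open[OF open_slit_plane]
  by (intro ballI exI, rule psi_has_field_derivative)

lemma gf_denom_holomorphic: "gf_denom p holomorphic_on slit_plane"
proof -
  have "(\<lambda>z. (1 - z) * (1 + of_real p * psi p z)) holomorphic_on slit_plane"
    by (intro holomorphic_on_mult holomorphic_on_add holomorphic_on_diff holomorphic_on_const
        holomorphic_on_ident psi_holomorphic)
  then show ?thesis by (simp add: gf_denom_def cong: holomorphic_cong)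
qed

lemma gf_denom_has_field_derivative:
  assumes z: "z \<in> slit_plane"
  shows "(gf_denom p has_field_derivative
           (- (1 + of_real p * psi p z) - of_real p * (1 + of_real (2 * p - 1) * psi p z))) (at z)"
proof -
  have nz: "1 - z \<noteq> 0" using slit_plane_not_1[OF z] by simp
  have "((\<lambda>z. (1 - z) * (1 + of_real p * psi p z)) has_field_derivative
      ((0 - 1) * (1 + of_real p * psi p z) +
       (0 + of_real p * (- (1 + of_real (2 * p - 1) * psi p z) / (1 - z))) * (1 - z))) (at z)"
    by (intro DERIV_mult DERIV_add DERIV_diff DERIV_const DERIV_ident DERIV_cmult psi_has_field_derivative z)
  moreover have "gf_denom p = (\<lambda>z. (1 - z) * (1 + of_real p * psi p z))"
    by (simp add: gf_denom_def fun_eq_iff)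
  moreover have "(0 - 1) * (1 + of_real p * psi p z) +
       (0 + of_real p * (- (1 + of_real (2 * p - 1) * psi p z) / (1 - z))) * (1 - z) =
       - (1 + of_real p * psi p z) - of_real p * (1 + of_real (2 * p - 1) * psi p z)"
    using nz by simp (simp add: algebra_simps)
  ultimately show ?thesis by metis
qed

text \<open>The formal solution is obtained from the Taylor series of \<open>psi p\<close> at
  \<open>0\<close>. The differential equation is a recurrence with real coefficients, which forces
  the Taylor coefficients to be real.\<close>

lemma psi_fps:
  obtains \<Psi> :: "real fps"
  where "(1 - fps_X) * fps_deriv \<Psi> = - (1 + fps_const (2 * p - 1) * \<Psi>)" "\<Psi> $ 0 = 0"
    and "psi p has_fps_expansion Abs_fps (\<lambda>n. of_real (\<Psi> $ n))"
proof -
  define A where "A = fps_expansion (psi p) 0"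
  have A: "psi p has_fps_expansion A"
    unfolding A_def by (rule has_fps_expansion_fps_expansion[OF open_slit_plane zero_in_slit_plane psi_holomorphic])
  have A0: "A $ 0 = 0" using fps_nth_fps_expansion[OF A, of 0] by simp
  define c where "c = complex_of_real (2 * p - 1)"
  have lhs: "(\<lambda>z. (1 - z) * deriv (psi p) z) has_fps_expansion (1 - fps_X) * fps_deriv A"
    by (intro fps_expansion_intros A)
  have rhs: "(\<lambda>z. - (1 + c * psi p z)) has_fps_expansion - (1 + fps_const c * A)"
    by (intro fps_expansion_intros A)
  have ev: "eventually (\<lambda>z. (1 - z) * deriv (psi p) z = - (1 + c * psi p z)) (nhds 0)"
    using eventually_nhds_in_open[OF open_slit_plane zero_in_slit_plane]
  proof eventually_elim
    case (elim z)
    have "1 - z \<noteq> 0" using slit_plane_not_1[OF elim] by simp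
    then show ?case
      using DERIV_imp_deriv[OF psi_has_field_derivative[OF elim, of p]] by (simp add: c_def)
  qed
  have ode: "(1 - fps_X) * fps_deriv A = - (1 + fps_const c * A)"
    using iffD1[OF has_fps_expansion_cong[OF ev refl] lhs] rhs by (rule fps_expansion_unique_complex)
  have shift: "((1 - fps_X) * fps_deriv F) $ n = of_nat (Suc n) * F $ Suc n - of_nat n * F $ n"
    for n and F :: "'a :: {comm_ring_1} fps"
    by (cases n) (simp_all add: left_diff_distrib algebra_simps)
  have rec: "of_nat (Suc n) * A $ Suc n = of_nat n * A $ n - ((1 :: complex fps) $ n + c * A $ n)" for n
  proof -
    have "((1 - fps_X) * fps_deriv A) $ n = (- (1 + fps_const c * A)) $ n" using ode by simp
    then show ?thesis unfolding shift by (simp add: algebra_simps)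
  qed
  have real: "Im (A $ n) = 0" for n
  proof (induction n)
    case (Suc n)
    have "Im (of_nat (Suc n) * A $ Suc n) = 0"
      unfolding rec using Suc.IH by (simp add: c_def)
    then show ?case by (simp del: of_nat_Suc)
  qed (simp add: A0)
  define \<Psi> where "\<Psi> = Abs_fps (\<lambda>n. Re (A $ n))"
  have A\<Psi>: "A = Abs_fps (\<lambda>n. of_real (\<Psi> $ n))"
    using real by (simp add: fps_eq_iff \<Psi>_def complex_eq_iff)
  have "(1 - fps_X) * fps_deriv \<Psi> = - (1 + fps_const (2 * p - 1) * \<Psi>)"
  proof (rule fps_ext)
    fix n
    have "Re (of_nat (Suc n) * A $ Suc n) = Re (of_nat n * A $ n - ((1 :: complex fps) $ n + c * A $ n))"
      unfolding rec ..
    then have "real (Suc n) * \<Psi> $ Suc n = real n * \<Psi> $ n - ((1 :: real fps) $ n + (2 * p - 1) * \<Psi> $ n)"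
      by (simp add: \<Psi>_def c_def fps_one_nth del: of_nat_Suc)
    then show "((1 - fps_X) * fps_deriv \<Psi>) $ n = (- (1 + fps_const (2 * p - 1) * \<Psi>)) $ n"
      unfolding shift by (simp add: algebra_simps)
  qed
  moreover have "\<Psi> $ 0 = 0" by (simp add: \<Psi>_def A0)
  moreover have "psi p has_fps_expansion Abs_fps (\<lambda>n. of_real (\<Psi> $ n))"
    using A unfolding A\<Psi> .
  ultimately show ?thesis by (rule that)
qed

text \<open>The value of \<open>log (1 - z)\<close> at the pole, that is, the real root of
  \<open>1 + p psi = 0\<close> written in terms of this logarithm.\<close>

definition pole_log :: "real \<Rightarrow> real" where
  "pole_log p = (if p = 1/2 then - 2 else ln ((1 - p) / p) / (2 * p - 1))"

lemma pole_log_neg: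
  assumes "0 < p" "p < 1"
  shows "pole_log p < 0"
proof -
  consider "p = 1/2" | "p < 1/2" | "p > 1/2" by linarith
  then show ?thesis
  proof cases
    case 2
    then have "ln ((1 - p) / p) > 0" using assms by (intro ln_gt_zero) (simp add: field_simps)
    with 2 show ?thesis by (simp add: pole_log_def divide_pos_neg)
  next
    case 3
    then have "ln ((1 - p) / p) < 0" using assms by (intro ln_less_zero) (simp_all add: field_simps)
    with 3 show ?thesis by (simp add: pole_log_def divide_neg_pos)
  qed (simp add: pole_log_def)
qed

lemma alpha_p_eq:
  assumes "0 < p" "p < 1"
  shows "alpha_p p = 1 / (1 - exp (pole_log p))"
proof (cases "p = 1/2")
  case False
  have "(p / (1 - p)) powr (1 / (1 - 2 * p)) = exp (1 / (1 - 2 * p) * ln (p / (1 - p)))"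
    using assms by (simp add: powr_def)
  also have "ln (p / (1 - p)) = - ln ((1 - p) / p)"
    using assms by (simp add: ln_div)
  also have "1 / (1 - 2 * p) * - ln ((1 - p) / p) = pole_log p"
    using False by (simp add: pole_log_def divide_simps) (simp add: algebra_simps)
  finally show ?thesis using False by (simp add: alpha_p_def)
qed (simp add: alpha_p_def pole_log_def)

text \<open>For \<open>p \<noteq> 1/2\<close> the equation fixes
  \<open>exp ((2p - 1) Ln (1 - z))\<close>. As \<open>|2p - 1| < 1\<close>, the exponent stays in
  the strip of imaginary parts below \<open>pi\<close> in modulus, where \<open>exp\<close> is
  injective, so there is no root besides the real one.\<close>

lemma one_plus_psi_eq_0_iff:
  assumes p: "0 < p" "p < 1" and z: "z \<in> slit_plane"
  shows "1 + of_real p * psi p z = 0 \<longleftrightarrow> z = of_real (1 - exp (pole_log p))"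
proof -
  have notin: "1 - z \<notin> \<real>\<^sub>\<le>\<^sub>0" and nz: "1 - z \<noteq> 0"
    using z slit_plane_not_1[OF z] by (auto simp: slit_plane_def)
  have arg: "\<bar>Im (Ln (1 - z))\<bar> < pi"
    using Im_Ln_less_pi[OF notin] mpi_less_Im_Ln[OF nz] by simp
  have "1 + of_real p * psi p z = 0 \<longleftrightarrow> Ln (1 - z) = of_real (pole_log p)"
  proof (cases "p = 1/2")
    case True
    have "1 + complex_of_real (1/2) * L = 0 \<longleftrightarrow> L = - 2" for L
    proof -
      have eq: "1 + complex_of_real (1/2) * L = (L + 2) / 2" by (simp add: field_simps)
      show ?thesis unfolding eq by (simp add: eq_neg_iff_add_eq_0)
    qed
    then show ?thesis unfolding True psi_def pole_log_def by simp
  next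
    case False
    define s where "s = 2 * p - 1"
    have s: "s \<noteq> 0" "\<bar>s\<bar> < 1" using False p by (auto simp: s_def)
    define R where "R = (1 - p) / p"
    have R: "R > 0" using p by (simp add: R_def)
    have "1 + of_real p * psi p z = 0 \<longleftrightarrow> (1 - z) powr of_real s = of_real R"
    proof -
      have "psi p z = ((1 - z) powr of_real s - 1) / of_real s"
        using False by (simp add: psi_def s_def)
      moreover have "1 + of_real p * ((w - 1) / of_real s) = 0 \<longleftrightarrow> w = of_real R" for w :: complex
      proof -
        have "1 + of_real p * ((w - 1) / of_real s) = 0 \<longleftrightarrow> of_real s + of_real p * (w - 1) = 0"
        proof -
          have eq: "1 + of_real p * ((w - 1) / of_real s) = (of_real s + of_real p * (w - 1)) / complex_of_real s"
            using s by (simp add: field_simps)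
          show ?thesis unfolding eq using s by simp
        qed
        also have "\<dots> \<longleftrightarrow> of_real p * w = of_real (1 - p)"
          by (auto simp: s_def algebra_simps add_eq_0_iff)
        also have "\<dots> \<longleftrightarrow> w = of_real R"
          using p by (auto simp: R_def field_simps)
        finally show ?thesis .
      qed
      ultimately show ?thesis by simp
    qed
    also have "\<dots> \<longleftrightarrow> exp (of_real s * Ln (1 - z)) = of_real R"
      using nz by (simp add: powr_def)
    also have "\<dots> \<longleftrightarrow> of_real s * Ln (1 - z) = of_real (ln R)"
    proof
      assume *: "exp (of_real s * Ln (1 - z)) = of_real R"
      have "\<bar>Im (of_real s * Ln (1 - z))\<bar> = \<bar>s\<bar> * \<bar>Im (Ln (1 - z))\<bar>" by (simp add: abs_mult)
      also have "\<dots> \<le> 1 * \<bar>Im (Ln (1 - z))\<bar>" using s by (intro mult_right_mono) auto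
      also have "\<dots> < pi" using arg by simp
      finally have "Ln (exp (of_real s * Ln (1 - z))) = of_real s * Ln (1 - z)"
        by (intro Ln_exp) auto
      then show "of_real s * Ln (1 - z) = of_real (ln R)"
        unfolding * using R by (simp add: Ln_of_real)
    next
      assume "of_real s * Ln (1 - z) = of_real (ln R)"
      then show "exp (of_real s * Ln (1 - z)) = of_real R"
        using R by (simp add: exp_of_real)
    qed
    also have "\<dots> \<longleftrightarrow> Ln (1 - z) = of_real (pole_log p)"
      using s False unfolding pole_log_def R_def[symmetric] s_def[symmetric]
      by (auto simp: field_simps)
    finally show ?thesis .
  qed
  also have "\<dots> \<longleftrightarrow> 1 - z = of_real (exp (pole_log p))"
  proof
    assume "Ln (1 - z) = of_real (pole_log p)"
    then show "1 - z = of_real (exp (pole_log p))"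
      using exp_Ln[OF nz] by (simp add: exp_of_real)
  qed (simp add: Ln_of_real)
  also have "\<dots> \<longleftrightarrow> z = of_real (1 - exp (pole_log p))"
    by (auto simp: algebra_simps)
  finally show ?thesis .
qed

text \<open>Two removable singularities: dividing the denominator by \<open>z - a\<close> leaves a
  function \<open>Q\<close> without zeros, and the difference quotient of \<open>1 / Q\<close> at
  \<open>a\<close> is the generating function minus its polar part.\<close>

lemma gf_minus_pole_holomorphic:
  assumes p: "0 < p" "p < 1"
  defines "z0 \<equiv> 1 - exp (pole_log p)"
  obtains h where "h holomorphic_on slit_plane"
    and "\<And>z. z \<in> slit_plane \<Longrightarrow> z \<noteq> of_real z0 \<Longrightarrow>
           h z = 1 / gf_denom p z - 1 / (of_real (1 - p) * (of_real z0 - z))"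
proof -
  define a where "a = complex_of_real z0"
  have z0: "0 < z0" "z0 < 1" using pole_log_neg[OF p] by (auto simp: z0_def)
  have a_in: "a \<in> slit_plane" using z0 by (intro ball_subset_slit_plane) (simp add: a_def)
  have psi_a: "1 + of_real p * psi p a = 0"
    using one_plus_psi_eq_0_iff[OF p a_in] by (simp add: a_def z0_def)
  have W_a: "gf_denom p a = 0" by (simp add: gf_denom_def psi_a)
  have W_nz: "gf_denom p z \<noteq> 0" if "z \<in> slit_plane" "z \<noteq> a" for z
    using one_plus_psi_eq_0_iff[OF p that(1)] that slit_plane_not_1[OF that(1)]
    by (simp add: gf_denom_def a_def z0_def)
  \<comment> \<open>The differential equation and \<open>p psi = -1\<close> give the derivative, so
    no explicit value of the pole is needed.\<close>
  have deriv_a: "deriv (gf_denom p) a = - of_real (1 - p)"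
  proof -
    have "of_real p * psi p a = - 1" using psi_a by (simp add: add_eq_0_iff)
    then have "of_real p * (1 + of_real (2 * p - 1) * psi p a) = complex_of_real p + of_real (2 * p - 1) * - 1"
      by (simp only: distrib_left mult.left_commute[of "of_real p"] mult_1_right)
    then show ?thesis
      using DERIV_imp_deriv[OF gf_denom_has_field_derivative[OF a_in, of p]] psi_a by simp
  qed
  define Q where "Q = (\<lambda>z. if z = a then deriv (gf_denom p) a else (gf_denom p z - gf_denom p a) / (z - a))"
  have Q_hol: "Q holomorphic_on slit_plane"
    unfolding Q_def by (intro pole_lemma_open gf_denom_holomorphic open_slit_plane)
  have Q_nz: "Q z \<noteq> 0" if "z \<in> slit_plane" for z
    using W_nz[OF that] p by (auto simp: Q_def deriv_a W_a)
  define g where "g = (\<lambda>z. 1 / Q z)"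
  have g_hol: "g holomorphic_on slit_plane"
    unfolding g_def using Q_nz by (intro holomorphic_intros Q_hol) auto
  define h where "h = (\<lambda>z. if z = a then deriv g a else (g z - g a) / (z - a))"
  have "h holomorphic_on slit_plane"
    unfolding h_def by (intro pole_lemma_open g_hol open_slit_plane)
  moreover have "h z = 1 / gf_denom p z - 1 / (of_real (1 - p) * (of_real z0 - z))"
    if z: "z \<in> slit_plane" "z \<noteq> of_real z0" for z
  proof -
    have ne: "z - a \<noteq> 0" using z by (simp add: a_def)
    have "g z = (z - a) / gf_denom p z" using ne by (simp add: g_def Q_def W_a)
    moreover have "g a = - (1 / of_real (1 - p))" by (simp add: g_def Q_def deriv_a del: of_real_diff)
    ultimately have "h z = (z - a) / gf_denom p z / (z - a) + 1 / of_real (1 - p) / (z - a)"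
      using ne by (simp add: h_def add_divide_distrib)
    moreover have "1 / of_real (1 - p) / (z - a) = - (1 / (of_real (1 - p) * (a - z)))"
      by (simp only: minus_diff_eq[of z a, symmetric] mult_minus_right divide_minus_right minus_minus
          divide_divide_eq_left)
    ultimately show ?thesis using ne by (simp add: a_def)
  qed
  ultimately show ?thesis by (rule that)
qed

lemma compact_wide_sector_annulus:
  assumes "0 < \<epsilon>"
  shows "compact {z \<in> wide_sector. \<epsilon> \<le> norm (1 - z) \<and> norm (1 - z) \<le> b}"
proof -
  have eq: "{z \<in> wide_sector. \<epsilon> \<le> norm (1 - z) \<and> norm (1 - z) \<le> b} =
      {z. - norm (1 - z) / 2 \<le> Re (1 - z)} \<inter> {z. \<epsilon> \<le> norm (1 - z)} \<inter> {z. norm (1 - z) \<le> b}"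
    using assms by (auto simp: wide_sector_def)
  have cb: "{z :: complex. norm (1 - z) \<le> b} = cball 1 b"
    by (auto simp: dist_norm)
  show ?thesis
    unfolding eq cb
    by (intro closed_Int_compact closed_Int closed_Collect_le continuous_intros compact_cball) auto
qed

section \<open>Analytic functions and their coefficients\<close>

lemma generating_function_fps:
  assumes p: "0 < p" "p < 1"
  shows "(\<lambda>z. 1 / gf_denom p z) has_fps_expansion Abs_fps (\<lambda>m. complex_of_real (EP p (Suc m)))"
proof -
  obtain \<Psi> :: "real fps" where \<Psi>:
    "(1 - fps_X) * fps_deriv \<Psi> = - (1 + fps_const (2 * p - 1) * \<Psi>)" "\<Psi> $ 0 = 0"
    "psi p has_fps_expansion Abs_fps (\<lambda>n. of_real (\<Psi> $ n))"
    using psi_fps by blast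
  \<comment> \<open>The coefficientwise embedding of real series into complex ones; being
    multiplicative, it carries inverses over.\<close>
  define C where "C = (\<lambda>F :: real fps. Abs_fps (\<lambda>n. complex_of_real (F $ n)))"
  have C_mult: "C (F * G) = C F * C G" for F G
    by (simp add: C_def fps_eq_iff fps_mult_nth)
  define D where "D = 1 + fps_const p * \<Psi>"
  have D_inv: "D * inverse D = 1" by (rule inverse_mult_eq_1') (simp add: D_def \<Psi>)
  have C_D: "C D = 1 + fps_const (complex_of_real p) * C \<Psi>"
    by (simp add: C_def D_def fps_eq_iff fps_one_nth)
  have C_X: "C (1 - fps_X) = 1 - fps_X"
    by (simp add: C_def fps_eq_iff fps_one_nth fps_X_def)
  have "(\<lambda>z. (1 - z) * (1 + of_real p * psi p z)) has_fps_expansion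
      (1 - fps_X) * (1 + fps_const (of_real p) * C \<Psi>)"
    unfolding C_def by (intro fps_expansion_intros \<Psi>)
  then have "(\<lambda>z. gf_denom p z) has_fps_expansion C (1 - fps_X) * C D"
    unfolding gf_denom_def C_D C_X .
  moreover have "(C (1 - fps_X) * C D) $ 0 \<noteq> 0" by (simp add: C_def D_def \<Psi>)
  ultimately have "(\<lambda>z. inverse (gf_denom p z)) has_fps_expansion inverse (C (1 - fps_X) * C D)"
    by (rule has_fps_expansion_inverse)
  moreover have "inverse (C (1 - fps_X) * C D) = C (fps_geo * inverse D)"
  proof (rule fps_inverse_unique)
    have "C (1 - fps_X) * C D * C (fps_geo * inverse D) = C (((1 - fps_X) * fps_geo) * (D * inverse D))"
      by (simp only: C_mult mult_ac)
    also have "\<dots> = 1" unfolding fps_geo_mult D_inv by (simp add: C_def fps_eq_iff fps_one_nth)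
    finally show "C (1 - fps_X) * C D * C (fps_geo * inverse D) = 1" .
  qed
  moreover have "C (fps_geo * inverse D) = Abs_fps (\<lambda>m. complex_of_real (EP p (Suc m)))"
    using EP_eq_coeff_psi[of p \<Psi>] p \<Psi> by (simp add: C_def D_def)
  ultimately show ?thesis by (simp add: inverse_eq_divide)
qed

lemma simple_pole_fps:
  fixes c z0 :: complex
  assumes "c \<noteq> 0" "z0 \<noteq> 0"
  shows "(\<lambda>z. 1 / (c * (z0 - z))) has_fps_expansion Abs_fps (\<lambda>n. 1 / c * (1 / z0) ^ Suc n)"
proof -
  have "(\<lambda>z. inverse (c * (z0 - z))) has_fps_expansion inverse (fps_const c * (fps_const z0 - fps_X))"
    using assms by (intro fps_expansion_intros) auto
  moreover have "inverse (fps_const c * (fps_const z0 - fps_X)) = Abs_fps (\<lambda>n. 1 / c * (1 / z0) ^ Suc n)"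
  proof (rule fps_inverse_unique, rule fps_ext)
    fix n
    show "(fps_const c * (fps_const z0 - fps_X) * Abs_fps (\<lambda>n. 1 / c * (1 / z0) ^ Suc n)) $ n = (1 :: complex fps) $ n"
      using assms by (cases n) (simp_all add: mult.assoc left_diff_distrib)
  qed
  ultimately show ?thesis by (simp add: inverse_eq_divide)
qed

text \<open>The polar part has coefficients \<open>alpha^(m+1) / (1 - p)\<close>. As the coefficient
  of \<open>z^m\<close> belongs to size \<open>m + 1\<close>, this is exactly the term subtracted in
  \<open>R_p\<close>.\<close>

lemma remainder_fps:
  assumes p: "0 < p" "p < 1"
  defines "z0 \<equiv> 1 - exp (pole_log p)"
  assumes h: "\<And>z. z \<in> slit_plane \<Longrightarrow> z \<noteq> of_real z0 \<Longrightarrow>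
           h z = 1 / gf_denom p z - 1 / (of_real (1 - p) * (of_real z0 - z))"
  shows "h has_fps_expansion Abs_fps (\<lambda>m. complex_of_real (R_p p (Suc m)))"
proof -
  have z0: "0 < z0" "z0 < 1" using pole_log_neg[OF p] by (auto simp: z0_def)
  have al: "alpha_p p = 1 / z0" unfolding z0_def by (rule alpha_p_eq[OF p])
  have "(\<lambda>z. 1 / gf_denom p z - 1 / (of_real (1 - p) * (of_real z0 - z))) has_fps_expansion
      Abs_fps (\<lambda>m. complex_of_real (EP p (Suc m))) -
      Abs_fps (\<lambda>n. 1 / complex_of_real (1 - p) * (1 / complex_of_real z0) ^ Suc n)"
    using p z0 by (intro has_fps_expansion_diff generating_function_fps simple_pole_fps) auto
  also have "Abs_fps (\<lambda>m. complex_of_real (EP p (Suc m))) -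
      Abs_fps (\<lambda>n. 1 / complex_of_real (1 - p) * (1 / complex_of_real z0) ^ Suc n) =
      Abs_fps (\<lambda>m. complex_of_real (R_p p (Suc m)))"
    by (simp add: fps_eq_iff R_p_def al)
  finally have *: "(\<lambda>z. 1 / gf_denom p z - 1 / (of_real (1 - p) * (of_real z0 - z))) has_fps_expansion
      Abs_fps (\<lambda>m. complex_of_real (R_p p (Suc m)))" .
  have "eventually (\<lambda>z. z \<in> slit_plane - {of_real z0}) (nhds 0)"
    using z0 zero_in_slit_plane open_slit_plane by (intro eventually_nhds_in_open) auto
  then have "eventually (\<lambda>z. 1 / gf_denom p z - 1 / (of_real (1 - p) * (of_real z0 - z)) = h z) (nhds 0)"
    by eventually_elim (use h in auto)
  from iffD1[OF has_fps_expansion_cong[OF this refl] *] show ?thesis .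
qed

text \<open>Closer to \<open>1\<close> than half the distance of the pole, the polar part varies by
  \<open>O(|1 - z|)\<close>, which suits every exponent \<open>- a \<le> 1\<close>. For
  \<open>p = 1/2\<close>, where the exponent is \<open>-1/2\<close>, boundedness is enough.\<close>

lemma pole_part_bounds:
  fixes z0 c :: real and z :: complex
  assumes "z0 < 1" "c > 0" "norm (1 - z) \<le> (1 - z0) / 2"
  shows "norm (1 / (of_real c * (of_real z0 - 1)) - 1 / (of_real c * (of_real z0 - z)))
           \<le> 2 / (c * (1 - z0)\<^sup>2) * norm (1 - z)"
    and "norm (1 / (of_real c * (of_real z0 - z))) \<le> 2 / (c * (1 - z0))"
    and "z \<noteq> of_real z0"
proof -
  have n1: "norm (of_real z0 - 1 :: complex) = 1 - z0"
    using assms by (metis abs_of_neg diff_less_0_iff_less minus_diff_eq norm_of_real of_real_1 of_real_diff)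
  have n2: "norm (of_real z0 - z) \<ge> (1 - z0) / 2"
    using norm_triangle_ineq2[of "of_real z0 - 1" "z - 1"] n1 assms(3) norm_minus_commute[of z 1] by simp
  then show ne: "z \<noteq> of_real z0" using assms by auto
  then have ne': "of_real z0 - z \<noteq> 0" "of_real z0 - 1 \<noteq> (0 :: complex)" using n1 assms by auto
  have "norm (1 / (of_real c * (of_real z0 - z))) = 1 / (c * norm (of_real z0 - z))"
    using assms by (simp add: norm_divide norm_mult)
  also have "\<dots> \<le> 1 / (c * ((1 - z0) / 2))"
    using n2 assms ne' by (intro divide_left_mono mult_left_mono mult_pos_pos) auto
  finally show "norm (1 / (of_real c * (of_real z0 - z))) \<le> 2 / (c * (1 - z0))" by simp
  have "1 / (of_real c * (of_real z0 - 1)) - 1 / (of_real c * (of_real z0 - z)) =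
      (1 - z) / (of_real c * (of_real z0 - 1) * (of_real z0 - z))"
    using ne' assms by (simp add: divide_simps)
  also have "norm \<dots> = norm (1 - z) / (c * (1 - z0) * norm (of_real z0 - z))"
    using assms by (simp add: norm_divide norm_mult n1)
  also have "\<dots> \<le> norm (1 - z) / (c * (1 - z0) * ((1 - z0) / 2))"
    using n2 assms ne' by (intro divide_left_mono mult_left_mono mult_pos_pos) auto
  also have "\<dots> = 2 / (c * (1 - z0)\<^sup>2) * norm (1 - z)"
    by (simp add: power2_eq_square mult_ac)
  finally show "norm (1 / (of_real c * (of_real z0 - 1)) - 1 / (of_real c * (of_real z0 - z)))
      \<le> 2 / (c * (1 - z0)\<^sup>2) * norm (1 - z)" .
qed

text \<open>On a compact set avoiding \<open>1\<close>, \<open>|g|\<close> times any power of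
  \<open>|1 - z|\<close> is bounded, so only the behaviour near \<open>1\<close> restricts the
  exponent.\<close>

lemma bounded_wide_sector_annulus:
  assumes "g holomorphic_on slit_plane" "0 < \<epsilon>"
  obtains B where "\<And>z. z \<in> wide_sector \<Longrightarrow> \<epsilon> \<le> norm (1 - z) \<Longrightarrow> norm (1 - z) \<le> b \<Longrightarrow>
      norm (g z) \<le> B * norm (1 - z) powr (- a)"
proof -
  let ?K = "{z \<in> wide_sector. \<epsilon> \<le> norm (1 - z) \<and> norm (1 - z) \<le> b}"
  have sub: "?K \<subseteq> slit_plane" using wide_sector_subset by blast
  have "continuous_on ?K g"
    by (rule holomorphic_on_imp_continuous_on[OF holomorphic_on_subset[OF assms(1) sub]])
  then have "continuous_on ?K (\<lambda>z. norm (g z) * norm (1 - z) powr a)"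
    using assms by (intro continuous_intros) auto
  then have "bounded ((\<lambda>z. norm (g z) * norm (1 - z) powr a) ` ?K)"
    by (intro compact_imp_bounded compact_continuous_image compact_wide_sector_annulus assms)
  then obtain B where B: "\<And>z. z \<in> ?K \<Longrightarrow> \<bar>norm (g z) * norm (1 - z) powr a\<bar> \<le> B"
    by (auto simp: bounded_iff)
  show ?thesis
  proof (rule that[of B])
    fix z assume z: "z \<in> wide_sector" "\<epsilon> \<le> norm (1 - z)" "norm (1 - z) \<le> b"
    have "norm (1 - z) > 0" using z assms by linarith
    then have "norm (g z) = (norm (g z) * norm (1 - z) powr a) * norm (1 - z) powr (- a)"
      by (simp add: powr_minus)
    also have "\<dots> \<le> B * norm (1 - z) powr (- a)"
      using B[of z] z by (intro mult_right_mono) auto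
    finally show "norm (g z) \<le> B * norm (1 - z) powr (- a)" .
  qed
qed

text \<open>The value at \<open>1\<close> of the subtracted pole is added back as a constant: this leaves all
  coefficients but the constant one unchanged, and the function becomes small enough at \<open>1\<close>
  even when \<open>a\<close> is negative.\<close>

lemma remainder_transfer:
  assumes p: "0 < p" "p < 1" and a: "- 1 < a" "a \<le> 1"
    and m: "m holomorphic_on slit_plane" "m has_fps_expansion M" and \<epsilon>: "0 < \<epsilon>"
    and near: "\<And>z. z \<in> wide_sector \<Longrightarrow> norm (1 - z) < \<epsilon> \<Longrightarrow>
                 norm (1 / gf_denom p z - m z) \<le> C * norm (1 - z) powr (- a)"
  obtains K where "\<And>n. n \<ge> 3 \<Longrightarrow> norm (of_real (R_p p (Suc n)) - M $ n) \<le> K * real n powr (a - 1)"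
proof -
  define z0 where "z0 = 1 - exp (pole_log p)"
  have z0: "z0 < 1" by (simp add: z0_def)
  obtain h where h: "h holomorphic_on slit_plane"
    "\<And>z. z \<in> slit_plane \<Longrightarrow> z \<noteq> of_real z0 \<Longrightarrow>
           h z = 1 / gf_denom p z - 1 / (of_real (1 - p) * (of_real z0 - z))"
    using gf_minus_pole_holomorphic[OF p] unfolding z0_def by blast
  have h_fps: "h has_fps_expansion Abs_fps (\<lambda>m. complex_of_real (R_p p (Suc m)))"
    by (rule remainder_fps[OF p]) (use h(2) in \<open>simp add: z0_def\<close>)
  define d where "d = 1 / (complex_of_real (1 - p) * (of_real z0 - 1))"
  define g where "g = (\<lambda>z. h z - m z + d)"
  have g_hol: "g holomorphic_on slit_plane" unfolding g_def by (intro holomorphic_intros h m)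
  have g_fps: "g has_fps_expansion Abs_fps (\<lambda>m. complex_of_real (R_p p (Suc m))) - M + fps_const d"
    unfolding g_def by (intro fps_expansion_intros h_fps m)
  define \<delta> where "\<delta> = Min {\<epsilon> / 2, (1 - z0) / 2, 1}"
  have \<delta>: "0 < \<delta>" "\<delta> < \<epsilon>" "\<delta> \<le> (1 - z0) / 2" "\<delta> \<le> 1" using \<epsilon> z0 by (auto simp: \<delta>_def min_def)
  define D where "D = 2 / ((1 - p) * (1 - z0)\<^sup>2)"
  have D: "D \<ge> 0" using p by (simp add: D_def)
  have close: "norm (g z) \<le> (\<bar>C\<bar> + D) * norm (1 - z) powr (- a)"
    if z: "z \<in> wide_sector" "norm (1 - z) \<le> \<delta>" for z
  proof -
    have x: "0 < norm (1 - z)" using z by (auto simp: wide_sector_def)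
    have z': "norm (1 - z) \<le> (1 - z0) / 2" using z \<delta> by linarith
    note pole = pole_part_bounds[OF z0 _ z', of "1 - p"]
    have "g z = (1 / gf_denom p z - m z) + (d - 1 / (of_real (1 - p) * (of_real z0 - z)))"
      using h(2)[of z] z wide_sector_subset pole(3) p by (auto simp: g_def)
    also have "norm \<dots> \<le> C * norm (1 - z) powr (- a) + D * norm (1 - z)"
      unfolding d_def D_def using near[OF z(1)] z \<delta> pole(1) p by (intro norm_triangle_mono) auto
    also have "\<dots> \<le> \<bar>C\<bar> * norm (1 - z) powr (- a) + D * norm (1 - z) powr (- a)"
    proof (intro add_mono mult_right_mono mult_left_mono)
      \<comment> \<open>The linear error of the polar part is absorbed because
        \<open>- a < 1\<close> and \<open>|1 - z| \<le> 1\<close>.\<close>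
      have "norm (1 - z) powr 1 \<le> norm (1 - z) powr (- a)"
        using z \<delta> a x by (intro powr_mono') auto
      then show "norm (1 - z) \<le> norm (1 - z) powr (- a)" using x by simp
    qed (use D in auto)
    finally show ?thesis by (simp add: distrib_right)
  qed
  obtain B where B: "\<And>z. z \<in> wide_sector \<Longrightarrow> \<delta> \<le> norm (1 - z) \<Longrightarrow> norm (1 - z) \<le> 3 \<Longrightarrow>
      norm (g z) \<le> B * norm (1 - z) powr (- a)"
    using bounded_wide_sector_annulus[OF g_hol \<delta>(1), of 3 a] by blast
  define M' where "M' = max (\<bar>C\<bar> + D) B"
  have bound: "norm (g z) \<le> M' * norm (1 - z) powr (- a)"
    if "z \<in> wide_sector" "norm (1 - z) \<le> 3" for z
  proof (cases "norm (1 - z) \<le> \<delta>")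
    case True
    then have "norm (g z) \<le> (\<bar>C\<bar> + D) * norm (1 - z) powr (- a)" using close that by blast
    also have "\<dots> \<le> M' * norm (1 - z) powr (- a)" by (intro mult_right_mono) (auto simp: M'_def)
    finally show ?thesis .
  next
    case False
    then have "norm (g z) \<le> B * norm (1 - z) powr (- a)" using B that by simp
    also have "\<dots> \<le> M' * norm (1 - z) powr (- a)" by (intro mult_right_mono) (auto simp: M'_def)
    finally show ?thesis .
  qed
  show ?thesis
  proof (rule that[of "5000 * M'"])
    fix n :: nat assume n: "n \<ge> 3"
    have "of_real (R_p p (Suc n)) - M $ n = (Abs_fps (\<lambda>m. complex_of_real (R_p p (Suc m))) - M + fps_const d) $ n"
      using n by simp
    also have "\<dots> = (deriv ^^ n) g 0 / fact n" by (rule fps_nth_fps_expansion[OF g_fps])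
    also have "norm \<dots> \<le> 5000 * M' * real n powr (a - 1)"
      by (rule coeff_transfer_bound[OF a n g_hol]) (use bound in auto)
    finally show "norm (of_real (R_p p (Suc n)) - M $ n) \<le> 5000 * M' * real n powr (a - 1)" .
  qed
qed

section \<open>Asymptotic expansions\<close>

text \<open>Coefficient \<open>n\<close> belongs to size \<open>n + 1\<close>; undoing the shift
  costs a constant, as \<open>n - 1 \<ge> n / 2\<close>.\<close>

lemma bigo_powr_SucI:
  fixes f :: "nat \<Rightarrow> real"
  assumes c: "c \<le> 0" and f: "\<And>n. n \<ge> 3 \<Longrightarrow> \<bar>f (Suc n)\<bar> \<le> K * real n powr c"
  shows "f \<in> O(\<lambda>n. real n powr c)"
proof (rule bigoI[of _ "\<bar>K\<bar> * 2 powr (- c)"])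
  have "\<bar>f n\<bar> \<le> \<bar>K\<bar> * 2 powr (- c) * real n powr c" if "n \<ge> 4" for n
  proof -
    define m where "m = n - 1"
    have m: "n = Suc m" "m \<ge> 3" using that by (auto simp: m_def)
    have "\<bar>f n\<bar> \<le> K * real m powr c" using f m by simp
    also have "\<dots> \<le> \<bar>K\<bar> * (real n / 2) powr c"
      using m c by (intro mult_mono powr_mono2') auto
    also have "(real n / 2) powr c = 2 powr (- c) * real n powr c"
      using m by (simp add: powr_divide powr_minus_divide)
    finally show ?thesis by (simp add: mult_ac)
  qed
  then show "eventually (\<lambda>n. norm (f n) \<le> \<bar>K\<bar> * 2 powr (- c) * norm (real n powr c)) sequentially"
    by (auto intro: eventually_sequentiallyI[of 4])
qed

section \<open>Behaviour at \<open>1\<close> for \<open>p \<noteq> 1/2\<close>\<close>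

lemma norm_powr_of_real: "norm ((z :: complex) powr of_real s) = norm z powr s"
  by (simp add: norm_powr_real_powr')

text \<open>Here \<open>u = (1 - z)^(2p - 1)\<close> tends to \<open>0\<close>, and the function is
  \<open>(2p - 1) / ((1 - z) v)\<close> with \<open>v = p u - (1 - p)\<close>. Replacing
  \<open>v\<close> by its limit costs a relative error of order \<open>|u|\<close>; the smallness
  assumption keeps \<open>v\<close> away from \<open>0\<close>.\<close>

lemma gf_near_one_above_half:
  assumes p: "1/2 < p" "p < 1" and z: "z \<in> wide_sector"
    and small: "norm (1 - z) powr (2 * p - 1) \<le> (1 - p) / 2"
  shows "norm (1 / gf_denom p z - 1 / (of_real (- (1 - p) / (2 * p - 1)) * (1 - z)))
           \<le> 2 * (2 * p - 1) * p / (1 - p)\<^sup>2 * norm (1 - z) powr (- (2 - 2 * p))"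
proof -
  define s where "s = 2 * p - 1"
  define \<zeta> where "\<zeta> = 1 - z"
  define u where "u = \<zeta> powr of_real s"
  have s: "0 < s" using p by (simp add: s_def)
  have \<zeta>: "\<zeta> \<noteq> 0" using z by (auto simp: wide_sector_def \<zeta>_def)
  have nu: "norm u = norm \<zeta> powr s" by (simp add: u_def norm_powr_of_real)
  define v where "v = of_real p * u - of_real (1 - p)"
  have v: "norm v \<ge> (1 - p) / 2"
  proof -
    have "norm (of_real p * u) \<le> 1 * ((1 - p) / 2)"
      unfolding norm_mult nu using small p by (intro mult_mono) (auto simp: s_def \<zeta>_def)
    moreover have "norm (of_real (1 - p) :: complex) = 1 - p" using p by (simp del: of_real_diff)
    ultimately show ?thesis
      unfolding v_def using norm_triangle_ineq2[of "of_real (1 - p)" "of_real p * u"]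
        norm_minus_commute[of "of_real (1 - p)" "of_real p * u"] by simp
  qed
  have vnz: "v \<noteq> 0" using v p by auto
  have snz: "complex_of_real s \<noteq> 0" using s by simp
  have qnz: "complex_of_real (1 - p) \<noteq> 0" using p by (simp del: of_real_diff)
  have "psi p z = (u - 1) / of_real s"
    using p by (simp add: psi_def u_def \<zeta>_def s_def)
  then have "gf_denom p z = \<zeta> * (1 + of_real p * ((u - 1) / of_real s))"
    by (simp add: gf_denom_def \<zeta>_def)
  also have "1 + of_real p * ((u - 1) / of_real s) = v / of_real s"
  proof -
    have "of_real s + of_real p * (u - 1) = v" by (simp add: v_def s_def algebra_simps)
    then show ?thesis using snz by (simp add: field_simps)
  qed
  finally have W: "gf_denom p z = \<zeta> * (v / of_real s)" .
  define q where "q = complex_of_real (1 - p)"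
  have c: "complex_of_real (- (1 - p) / s) = - (q / of_real s)" by (simp add: q_def minus_divide_left)
  have "1 / gf_denom p z - 1 / (of_real (- (1 - p) / s) * \<zeta>) = of_real s / \<zeta> * (1 / v + 1 / q)"
    unfolding W c using \<zeta> vnz snz qnz[folded q_def] by (simp add: field_simps)
  also have "1 / v + 1 / q = (v + q) / (v * q)"
    using vnz qnz[folded q_def] by (simp add: field_simps)
  also have "v + q = of_real p * u" by (simp add: v_def q_def)
  finally have eq: "1 / gf_denom p z - 1 / (of_real (- (1 - p) / s) * \<zeta>) =
      of_real s / \<zeta> * (of_real p * u / (v * of_real (1 - p)))" unfolding q_def .
  have "norm (1 / gf_denom p z - 1 / (of_real (- (1 - p) / s) * \<zeta>)) =
      s / norm \<zeta> * (p * norm \<zeta> powr s / (norm v * (1 - p)))"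
    unfolding eq norm_mult norm_divide nu norm_of_real using s p by simp
  also have "\<dots> \<le> s / norm \<zeta> * (p * norm \<zeta> powr s / ((1 - p) / 2 * (1 - p)))"
    using v p s \<zeta> vnz by (intro mult_left_mono divide_left_mono mult_right_mono mult_pos_pos) auto
  also have "\<dots> = 2 * s * p / (1 - p)\<^sup>2 * (norm \<zeta> powr s / norm \<zeta>)"
    using p by (simp add: power2_eq_square mult_ac)
  also have "norm \<zeta> powr s / norm \<zeta> = norm \<zeta> powr (- (2 - 2 * p))"
    using \<zeta> powr_diff[of "norm \<zeta>" s 1] by (simp add: s_def)
  finally show ?thesis by (simp add: s_def \<zeta>_def)
qed

text \<open>Now the small quantity is \<open>u = (1 - z)^(1 - 2p)\<close>, and the function is
  \<open>(1 - 2p) u / ((1 - z) v)\<close> with \<open>v\<close> tending to \<open>- p\<close>. The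
  main term already carries a factor \<open>u\<close>, so the error is of order
  \<open>|u|^2 / |1 - z|\<close>.\<close>

lemma gf_near_one_below_half:
  assumes p: "0 < p" "p < 1/2" and z: "z \<in> wide_sector"
    and small: "norm (1 - z) powr (1 - 2 * p) \<le> p / 2"
  shows "norm (1 / gf_denom p z - of_real (- (1 - 2 * p) / p) * (1 - z) powr of_real (- 2 * p))
           \<le> 2 * (1 - 2 * p) * (1 - p) / p\<^sup>2 * norm (1 - z) powr (- (4 * p - 1))"
proof -
  define s where "s = 1 - 2 * p"
  define \<zeta> where "\<zeta> = 1 - z"
  define u where "u = \<zeta> powr of_real s"
  have s: "0 < s" using p by (simp add: s_def)
  have \<zeta>: "\<zeta> \<noteq> 0" using z by (auto simp: wide_sector_def \<zeta>_def)
  have nu: "norm u = norm \<zeta> powr s" by (simp add: u_def norm_powr_of_real)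
  have unz: "u \<noteq> 0" using \<zeta> by (simp add: u_def)
  define v where "v = of_real (1 - p) * u - of_real p"
  have v: "norm v \<ge> p / 2"
  proof -
    have "norm (of_real (1 - p) * u) \<le> 1 * (p / 2)"
      unfolding norm_mult nu norm_of_real using small p by (intro mult_mono) (auto simp: s_def \<zeta>_def)
    moreover have "norm (of_real p :: complex) = p" using p by simp
    ultimately show ?thesis
      unfolding v_def using norm_triangle_ineq2[of "of_real p" "of_real (1 - p) * u"]
        norm_minus_commute[of "of_real p" "of_real (1 - p) * u"] by linarith
  qed
  have vnz: "v \<noteq> 0" using v p by auto
  have snz: "complex_of_real s \<noteq> 0" and pnz: "complex_of_real p \<noteq> 0" using s p by auto
  have "complex_of_real (2 * p - 1) = - of_real s" by (simp add: s_def)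
  then have "psi p z = (1 / u - 1) / - of_real s"
    using p by (simp add: psi_def u_def \<zeta>_def powr_minus_divide del: of_real_diff of_real_mult)
  then have "gf_denom p z = \<zeta> * (1 + of_real p * ((1 / u - 1) / - of_real s))"
    by (simp add: gf_denom_def \<zeta>_def)
  also have "1 + of_real p * ((1 / u - 1) / - of_real s) = v / (of_real s * u)"
  proof -
    have "of_real s * u - of_real p * (1 - u) = v" by (simp add: v_def s_def algebra_simps)
    then show ?thesis using snz unz by (simp add: field_simps)
  qed
  finally have W: "gf_denom p z = \<zeta> * (v / (of_real s * u))" .
  have pw: "\<zeta> powr of_real (- 2 * p) = u / \<zeta>"
  proof -
    have "complex_of_real (- 2 * p) = of_real s - 1" by (simp add: s_def)
    then show ?thesis using \<zeta> by (simp only: u_def powr_diff) simp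
  qed
  have "1 / gf_denom p z - of_real (- s / p) * \<zeta> powr of_real (- 2 * p) =
      of_real s * u / \<zeta> * (1 / v + 1 / of_real p)"
    unfolding W pw using \<zeta> vnz snz pnz unz by (simp add: divide_simps) (simp add: algebra_simps)
  also have "1 / v + 1 / of_real p = (v + of_real p) / (v * of_real p)"
    using vnz pnz by (simp add: field_simps)
  also have "v + of_real p = of_real (1 - p) * u" by (simp add: v_def)
  finally have eq: "1 / gf_denom p z - of_real (- s / p) * \<zeta> powr of_real (- 2 * p) =
      of_real s * u / \<zeta> * (of_real (1 - p) * u / (v * of_real p))" .
  have "norm (1 / gf_denom p z - of_real (- s / p) * \<zeta> powr of_real (- 2 * p)) =
      s * norm \<zeta> powr s / norm \<zeta> * ((1 - p) * norm \<zeta> powr s / (norm v * p))"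
    unfolding eq norm_mult norm_divide nu norm_of_real using s p by simp
  also have "\<dots> \<le> s * norm \<zeta> powr s / norm \<zeta> * ((1 - p) * norm \<zeta> powr s / (p / 2 * p))"
    using v p s \<zeta> vnz by (intro mult_left_mono divide_left_mono mult_right_mono mult_pos_pos) auto
  also have "\<dots> = 2 * s * (1 - p) / p\<^sup>2 * (norm \<zeta> powr s * norm \<zeta> powr s / norm \<zeta>)"
    using p by (simp add: power2_eq_square mult_ac)
  also have "norm \<zeta> powr s * norm \<zeta> powr s / norm \<zeta> = norm \<zeta> powr (s + s - 1)"
    using \<zeta> by (simp only: powr_diff powr_add) simp
  also have "s + s - 1 = - (4 * p - 1)" by (simp add: s_def)
  finally show ?thesis by (simp add: s_def \<zeta>_def)
qed

lemma asymptotics_above_half: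
  assumes p: "1/2 < p" "p < 1"
  shows "(\<lambda>n. R_p p n - (- (2*p - 1) / (1 - p))) \<in> O(\<lambda>n. real n powr (1 - 2*p))"
proof -
  define s where "s = 2 * p - 1"
  have s: "0 < s" using p by (simp add: s_def)
  define c where "c = complex_of_real (- (1 - p) / (2 * p - 1))"
  have c: "c \<noteq> 0" unfolding c_def of_real_eq_0_iff using p by simp
  \<comment> \<open>Solves \<open>\<epsilon> powr (2p - 1) = (1 - p) / 2\<close>, the threshold in
    the local estimate.\<close>
  define \<epsilon> where "\<epsilon> = ((1 - p) / 2) powr (1 / s)"
  have \<epsilon>: "0 < \<epsilon>" using p by (simp add: \<epsilon>_def)
  have \<epsilon>s: "\<epsilon> powr s = (1 - p) / 2" using p s by (simp add: \<epsilon>_def powr_powr)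
  have small: "norm (1 - z) powr (2 * p - 1) \<le> (1 - p) / 2" if "norm (1 - z) < \<epsilon>" for z :: complex
    using that s unfolding \<epsilon>s[symmetric] s_def[symmetric] by (intro powr_mono2) auto
  have m_hol: "(\<lambda>z. 1 / (c * (1 - z))) holomorphic_on slit_plane"
    using c slit_plane_not_1 by (intro holomorphic_intros) auto
  have m_fps: "(\<lambda>z. 1 / (c * (1 - z))) has_fps_expansion Abs_fps (\<lambda>n. 1 / c * (1 / 1) ^ Suc n)"
    by (rule simple_pole_fps) (use c in auto)
  have a: "- 1 < 2 - 2 * p" "2 - 2 * p \<le> 1" and p0: "0 < p" using p by auto
  obtain K where K: "\<And>n. n \<ge> 3 \<Longrightarrow>
      norm (of_real (R_p p (Suc n)) - Abs_fps (\<lambda>n. 1 / c * (1 / 1) ^ Suc n) $ n) \<le> K * real n powr (2 - 2 * p - 1)"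
    by (rule remainder_transfer[OF p0 p(2) a m_hol m_fps \<epsilon>
          gf_near_one_above_half[OF p _ small, folded c_def]]) blast+
  have cinv: "1 / c = of_real (- (2*p - 1) / (1 - p))"
  proof -
    have "- (2*p - 1) / (1 - p) = 1 / (- (1 - p) / (2 * p - 1))"
      using p by (simp add: divide_simps) (simp add: algebra_simps)
    then show ?thesis by (simp only: c_def of_real_divide of_real_1)
  qed
  show ?thesis
  proof (rule bigo_powr_SucI[of _ _ K])
    fix n :: nat assume "n \<ge> 3"
    from K[OF this] show "\<bar>R_p p (Suc n) - (- (2*p - 1) / (1 - p))\<bar> \<le> K * real n powr (1 - 2 * p)"
      by (simp add: cinv flip: of_real_diff del: of_real_divide of_real_minus)
  qed (use p in simp)
qed

section \<open>Coefficients of negative powers of \<open>1 - z\<close>\<close>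

lemma has_fps_expansion_one_minus_powr:
  "(\<lambda>z. (1 - z) powr of_real c) has_fps_expansion
     Abs_fps (\<lambda>n. complex_of_real ((-1) ^ n * (c gchoose n)))"
proof -
  have "((\<lambda>x. (1 + x) powr complex_of_real c) \<circ> (\<lambda>z. - z)) has_fps_expansion
      fps_compose (fps_binomial (complex_of_real c)) (- fps_X)"
    by (intro has_fps_expansion_compose fps_expansion_intros) simp
  moreover have "fps_compose (fps_binomial (complex_of_real c)) (- fps_X) =
      Abs_fps (\<lambda>n. complex_of_real ((-1) ^ n * (c gchoose n)))"
  proof -
    have "of_real (c gchoose n) = complex_of_real c gchoose n" for n
      by (simp add: gbinomial_prod_rev)
    then show ?thesis
      using fps_compose_linear[of "fps_binomial (complex_of_real c)" "- 1"]
      by (simp add: fps_eq_iff flip: fps_const_neg)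
  qed
  ultimately show ?thesis by (simp add: o_def)
qed

text \<open>Both are Bernoulli's inequality, which is Young's inequality with one argument
  \<open>1\<close>: once at \<open>1 + t\<close>, once at its reciprocal.\<close>

lemma one_plus_powr_bounds:
  fixes a t :: real
  assumes "0 \<le> a" "a \<le> 1" "0 \<le> t"
  shows "(1 + t) powr a \<le> 1 + a * t" "(1 + t) powr a \<ge> 1 + a * (t - t\<^sup>2)"
proof -
  have bern: "x powr a \<le> 1 + a * (x - 1)" if "x > 0" for x
    using Youngs_inequality_0[of a "1 - a" x 1] that assms by (simp add: algebra_simps)
  show "(1 + t) powr a \<le> 1 + a * t" using bern[of "1 + t"] assms by simp
  define y where "y = t / (1 + t)"
  have y: "0 \<le> y" "y < 1" "1 - y = 1 / (1 + t)" using assms by (auto simp: y_def field_simps)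
  have ay: "0 \<le> a * y" "a * y < 1"
    using y assms by (auto intro: mult_nonneg_nonneg le_less_trans[OF mult_right_mono[of a 1 y]])
  have "(1 - y) powr a \<le> 1 - a * y"
    using bern[of "1 - y"] y(2) by simp
  then have "1 / (1 + t) powr a \<le> 1 - a * y"
    unfolding y(3) using assms by (simp add: powr_divide)
  then have "1 \<le> (1 - a * y) * (1 + t) powr a"
    using assms by (simp add: pos_divide_le_eq)
  then have "1 / (1 - a * y) \<le> (1 + t) powr a"
    using ay by (simp add: pos_divide_le_eq mult.commute)
  moreover have "1 + a * y \<le> 1 / (1 - a * y)"
  proof -
    have "(1 + a * y) * (1 - a * y) = 1 - (a * y)\<^sup>2" by (simp add: algebra_simps power2_eq_square)
    also have "\<dots> \<le> 1" by simp
    finally show ?thesis using ay by (simp add: pos_le_divide_eq)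
  qed
  moreover have "t - t\<^sup>2 \<le> y"
    using assms by (simp add: y_def field_simps power2_eq_square)
  then have "1 + a * (t - t\<^sup>2) \<le> 1 + a * y" using assms by (simp add: mult_left_mono)
  ultimately show "(1 + t) powr a \<ge> 1 + a * (t - t\<^sup>2)" by linarith
qed

text \<open>The known limit has no rate, so monotonicity supplies one. The coefficients times
  \<open>(n + 1)^(1 - q)\<close> have consecutive ratios between \<open>1 - 2 t^2\<close> and
  \<open>1\<close>, where \<open>t = 1 / (n + 1)\<close>. So they decrease, while they increase
  after subtracting \<open>4 / (n + 1)\<close>, and both sequences tend to
  \<open>1 / Gamma q\<close>.\<close>

lemma gbinomial_coeff_asymptotic:
  fixes q :: real
  assumes q: "0 < q" "q < 1"
  shows "\<bar>(-1) ^ n * ((- q) gchoose n) - real (Suc n) powr (q - 1) / Gamma q\<bar>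
           \<le> 4 * real (Suc n) powr (q - 2)"
proof -
  define a where "a = 1 - q"
  have a: "0 \<le> a" "a \<le> 1" using q by (auto simp: a_def)
  define b where "b = (\<lambda>n. (-1) ^ n * ((- q) gchoose n))"
  define r where "r = (\<lambda>n. b n * real (Suc n) powr a)"
  have b_Suc: "b (Suc n) = b n * (1 - a / real (Suc n))" for n
  proof -
    have "real (Suc n) * ((- q) gchoose Suc n) = (- q - real n) * ((- q) gchoose n)"
      using gbinomial_mult_1[of "- q" n] by (simp add: algebra_simps)
    then have "((- q) gchoose Suc n) = (- q - real n) / real (Suc n) * ((- q) gchoose n)"
      by (simp add: field_simps del: of_nat_Suc)
    moreover have "1 - a / real (Suc n) = - ((- q - real n) / real (Suc n))"
      by (simp add: a_def field_simps)
    ultimately show ?thesis by (simp add: b_def)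
  qed
  have r_Suc: "r (Suc n) = r n * ((1 - a * t) * (1 + t) powr a)" if "t = 1 / real (Suc n)" for n t
  proof -
    have "real (Suc (Suc n)) = real (Suc n) * (1 + t)" by (simp add: that field_simps)
    then have "real (Suc (Suc n)) powr a = real (Suc n) powr a * (1 + t) powr a"
      using that by (simp add: powr_mult del: of_nat_Suc)
    then show ?thesis by (simp add: r_def b_Suc that del: of_nat_Suc)
  qed
  have factor: "(1 - a * t) * (1 + t) powr a \<le> 1" "(1 - a * t) * (1 + t) powr a \<ge> 1 - 2 * t\<^sup>2"
    if t: "0 \<le> t" "t \<le> 1" for t
  proof -
    have at: "a * t \<le> 1" using a t by (simp add: mult_le_one)
    have "(1 - a * t) * (1 + t) powr a \<le> (1 - a * t) * (1 + a * t)"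
      using one_plus_powr_bounds(1)[OF a t(1)] at by (intro mult_left_mono) auto
    also have "\<dots> = 1 - (a * t)\<^sup>2" by (simp add: algebra_simps power2_eq_square)
    also have "\<dots> \<le> 1" by simp
    finally show "(1 - a * t) * (1 + t) powr a \<le> 1" .
    have "a\<^sup>2 * t\<^sup>2 \<le> 1 * t\<^sup>2" using a by (intro mult_right_mono) (auto simp: power_le_one)
    moreover have "a * t\<^sup>2 \<le> 1 * t\<^sup>2" using a by (intro mult_right_mono) auto
    moreover have "a\<^sup>2 * t ^ 3 \<ge> 0" using t by simp
    ultimately have "1 - 2 * t\<^sup>2 \<le> 1 - a\<^sup>2 * t\<^sup>2 - a * t\<^sup>2 + a\<^sup>2 * t ^ 3" by linarith
    also have "\<dots> = (1 - a * t) * (1 + a * (t - t\<^sup>2))"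
      by (simp add: algebra_simps power2_eq_square power3_eq_cube)
    also have "\<dots> \<le> (1 - a * t) * (1 + t) powr a"
      using one_plus_powr_bounds(2)[OF a t(1)] at by (intro mult_left_mono) auto
    finally show "(1 - a * t) * (1 + t) powr a \<ge> 1 - 2 * t\<^sup>2" .
  qed
  have r01: "0 \<le> r n \<and> r n \<le> 1" for n
  proof (induction n)
    case (Suc n)
    define t where "t = 1 / real (Suc n)"
    have t: "0 \<le> t" "t \<le> 1" by (auto simp: t_def)
    have "a * t \<le> 1" using a t by (simp add: mult_le_one)
    then have "0 \<le> (1 - a * t) * (1 + t) powr a" by simp
    then show ?case unfolding r_Suc[OF t_def]
      using Suc.IH factor(1)[OF t] by (simp add: mult_le_one)
  qed (simp add: r_def b_def)
  have dec: "decseq r"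
  proof (rule decseq_SucI)
    fix n
    define t where "t = 1 / real (Suc n)"
    have "0 \<le> t" "t \<le> 1" by (auto simp: t_def)
    then have "r n * ((1 - a * t) * (1 + t) powr a) \<le> r n * 1"
      using r01[of n] factor(1)[of t] by (intro mult_left_mono) auto
    then show "r (Suc n) \<le> r n" unfolding r_Suc[OF t_def] by simp
  qed
  have inc: "incseq (\<lambda>n. r n - 4 / real (Suc n))"
  proof (rule incseq_SucI)
    fix n
    define t where "t = 1 / real (Suc n)"
    have t: "0 \<le> t" "t \<le> 1" by (auto simp: t_def)
    have "r n * (1 - 2 * t\<^sup>2) \<le> r n * ((1 - a * t) * (1 + t) powr a)"
      using r01[of n] factor(2)[OF t] by (intro mult_left_mono) auto
    then have "r n * (1 - 2 * t\<^sup>2) \<le> r (Suc n)" unfolding r_Suc[OF t_def] .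
    moreover have "r n * (2 * t\<^sup>2) \<le> 1 * (2 * t\<^sup>2)" using r01[of n] by (intro mult_right_mono) auto
    ultimately have "r n - 2 * t\<^sup>2 \<le> r (Suc n)" by (simp add: algebra_simps)
    \<comment> \<open>The source of the \<open>4\<close>: \<open>4 / (n + 1)\<close> drops by
      \<open>4 / ((n + 1) (n + 2))\<close>, and \<open>n + 2 \<le> 2 (n + 1)\<close>.\<close>
    moreover have "2 * t\<^sup>2 \<le> 4 / real (Suc n) - 4 / real (Suc (Suc n))"
    proof -
      have "4 / real (Suc n) - 4 / real (Suc (Suc n)) = 4 / (real (Suc n) * real (Suc (Suc n)))"
        by (simp add: field_simps)
      also have "\<dots> \<ge> 4 / (real (Suc n) * (2 * real (Suc n)))"
        by (intro divide_left_mono mult_left_mono mult_pos_pos) auto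
      also have "4 / (real (Suc n) * (2 * real (Suc n))) = 2 * t\<^sup>2"
        by (simp add: t_def power2_eq_square del: of_nat_Suc)
      finally show ?thesis .
    qed
    ultimately show "r n - 4 / real (Suc n) \<le> r (Suc n) - 4 / real (Suc (Suc n))" by linarith
  qed
  have lim: "r \<longlonglongrightarrow> 1 / Gamma q"
  proof -
    have "(\<lambda>n. ((- q) gchoose n) / ((-1) ^ n / exp ((- q + 1) * of_real (ln (real n))))) \<longlonglongrightarrow> inverse (Gamma (- (- q)))"
      by (rule gbinomial_asymptotic)
    then have "(\<lambda>n. ((- q) gchoose n) / ((-1) ^ n / exp (a * ln (real n)))) \<longlonglongrightarrow> 1 / Gamma q"
      by (simp add: a_def inverse_eq_divide add.commute)
    moreover have "(\<lambda>n. ((real n + 1) / real n) powr a) \<longlonglongrightarrow> 1 powr a"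
      by (intro tendsto_powr tendsto_const) (real_asymp, simp)
    ultimately have "(\<lambda>n. ((- q) gchoose n) / ((-1) ^ n / exp (a * ln (real n))) * ((real n + 1) / real n) powr a) \<longlonglongrightarrow> 1 / Gamma q * 1 powr a"
      by (rule tendsto_mult)
    moreover have "eventually (\<lambda>n. ((- q) gchoose n) / ((-1) ^ n / exp (a * ln (real n))) * ((real n + 1) / real n) powr a = r n) sequentially"
      using eventually_gt_at_top[of 0]
    proof eventually_elim
      case (elim n)
      have "exp (a * ln (real n)) = real n powr a" using elim by (simp add: powr_def)
      moreover have "((real n + 1) / real n) powr a = real (Suc n) powr a / real n powr a"
        using elim by (simp add: powr_divide add.commute)
      moreover have "x / ((-1) ^ n / y) = (-1) ^ n * x * y" for x y :: real
        by (cases "even n") auto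
      ultimately show ?case using elim by (simp add: r_def b_def)
    qed
    ultimately show ?thesis by (simp add: Lim_transform_eventually)
  qed
  have lim2: "(\<lambda>n. r n - 4 / real (Suc n)) \<longlonglongrightarrow> 1 / Gamma q"
  proof -
    have "(\<lambda>n. 4 / real (Suc n)) \<longlonglongrightarrow> 0" by real_asymp
    from tendsto_diff[OF lim this] show ?thesis by simp
  qed
  have "\<bar>r n - 1 / Gamma q\<bar> \<le> 4 / real (Suc n)"
    using decseq_ge[OF dec lim, of n] incseq_le[OF inc lim2, of n] by simp
  then have "\<bar>r n - 1 / Gamma q\<bar> * real (Suc n) powr (q - 1) \<le> 4 / real (Suc n) * real (Suc n) powr (q - 1)"
    by (intro mult_right_mono) auto
  moreover have "\<bar>r n - 1 / Gamma q\<bar> * real (Suc n) powr (q - 1) =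
      \<bar>(r n - 1 / Gamma q) * real (Suc n) powr (q - 1)\<bar>" by (simp add: abs_mult)
  moreover have "(r n - 1 / Gamma q) * real (Suc n) powr (q - 1) = b n - real (Suc n) powr (q - 1) / Gamma q"
  proof -
    have "real (Suc n) powr a * real (Suc n) powr (q - 1) = 1"
      by (simp add: a_def flip: powr_add)
    then show ?thesis by (simp add: r_def left_diff_distrib mult.assoc del: of_nat_Suc)
  qed
  moreover have "4 / real (Suc n) * real (Suc n) powr (q - 1) = 4 * real (Suc n) powr (q - 2)"
  proof -
    have "real (Suc n) powr (q - 2) = real (Suc n) powr (q - 1 - 1)" by simp
    also have "\<dots> = real (Suc n) powr (q - 1) / real (Suc n)" by (subst powr_diff) simp
    finally show ?thesis by (simp del: of_nat_Suc)
  qed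
  ultimately show ?thesis by (simp add: b_def)
qed

lemma asymptotics_below_half:
  assumes p: "0 < p" "p < 1/2"
  shows "(\<lambda>n. R_p p n - (- (1 - 2*p) / (p * Gamma (2*p)) * real n powr (2*p - 1)))
           \<in> O(\<lambda>n. real n powr (2 * (2*p - 1)))"
proof -
  define s where "s = 1 - 2 * p"
  have s: "0 < s" using p by (simp add: s_def)
  define c where "c = complex_of_real (- (1 - 2 * p) / p)"
  define \<epsilon> where "\<epsilon> = (p / 2) powr (1 / s)"
  have \<epsilon>: "0 < \<epsilon>" using p by (simp add: \<epsilon>_def)
  have \<epsilon>s: "\<epsilon> powr s = p / 2" using p s by (simp add: \<epsilon>_def powr_powr)
  have small: "norm (1 - z) powr (1 - 2 * p) \<le> p / 2" if "norm (1 - z) < \<epsilon>" for z :: complex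
    using that s unfolding \<epsilon>s[symmetric] s_def[symmetric] by (intro powr_mono2) auto
  define b where "b = (\<lambda>n. (-1) ^ n * ((- 2 * p) gchoose n))"
  have m_hol: "(\<lambda>z. c * (1 - z) powr of_real (- 2 * p)) holomorphic_on slit_plane"
    by (intro holomorphic_intros) (simp add: slit_plane_def)
  have m_fps: "(\<lambda>z. c * (1 - z) powr of_real (- 2 * p)) has_fps_expansion fps_const c * Abs_fps (\<lambda>n. of_real (b n))"
    unfolding b_def by (intro has_fps_expansion_cmult_left has_fps_expansion_one_minus_powr)
  have a: "- 1 < 4 * p - 1" "4 * p - 1 \<le> 1" and p1: "p < 1" using p by auto
  obtain K where K: "\<And>n. n \<ge> 3 \<Longrightarrow>
      norm (of_real (R_p p (Suc n)) - (fps_const c * Abs_fps (\<lambda>n. of_real (b n))) $ n) \<le> K * real n powr (4 * p - 1 - 1)"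
    by (rule remainder_transfer[OF p(1) p1 a m_hol m_fps \<epsilon>
          gf_near_one_below_half[OF p _ small, folded c_def]]) blast+
  define C where "C = (1 - 2 * p) / p"
  have C: "C \<ge> 0" using p by (simp add: C_def)
  show ?thesis
  proof (rule bigo_powr_SucI[of _ _ "K + C * 4"])
    fix n :: nat assume n: "n \<ge> 3"
    let ?N = "real (Suc n)"
    have "of_real (R_p p (Suc n)) - (fps_const c * Abs_fps (\<lambda>n. of_real (b n))) $ n =
        complex_of_real (R_p p (Suc n) + C * b n)"
    proof -
      have "c = - of_real C" 
        by (simp only: c_def C_def minus_divide_left[symmetric] of_real_minus)
      then show ?thesis by simp
    qed
    then have 1: "\<bar>R_p p (Suc n) + C * b n\<bar> \<le> K * real n powr (2 * (2 * p - 1))"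
      using K[OF n] by (simp add: norm_of_real del: of_real_add of_real_mult)
    have "\<bar>b n - ?N powr (2 * p - 1) / Gamma (2 * p)\<bar> \<le> 4 * ?N powr (2 * p - 2)"
      using gbinomial_coeff_asymptotic[of "2 * p" n] p by (simp add: b_def)
    \<comment> \<open>The error of the binomial coefficients is below the claimed one because
      \<open>2p - 2 \<le> 4p - 2\<close>.\<close>
    also have "\<dots> \<le> 4 * real n powr (2 * (2 * p - 1))"
    proof -
      have "?N powr (2 * p - 2) \<le> real n powr (2 * p - 2)" using n p by (intro powr_mono2') auto
      also have "\<dots> \<le> real n powr (2 * (2 * p - 1))" using n p by (intro powr_mono) auto
      finally show ?thesis by simp
    qed
    finally have 2: "C * \<bar>b n - ?N powr (2 * p - 1) / Gamma (2 * p)\<bar> \<le> C * (4 * real n powr (2 * (2 * p - 1)))"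
      using C by (rule mult_left_mono)
    have "R_p p (Suc n) - (- (1 - 2*p) / (p * Gamma (2*p)) * ?N powr (2*p - 1)) =
        (R_p p (Suc n) + C * b n) - C * (b n - ?N powr (2 * p - 1) / Gamma (2 * p))"
    proof -
      have "- (1 - 2*p) / (p * Gamma (2*p)) * ?N powr (2*p - 1) = - (C * (?N powr (2 * p - 1) / Gamma (2 * p)))"
        unfolding C_def minus_divide_left[symmetric] by simp
      then show ?thesis by (simp add: right_diff_distrib)
    qed
    also have "\<bar>\<dots>\<bar> \<le> \<bar>R_p p (Suc n) + C * b n\<bar> + \<bar>C * (b n - ?N powr (2 * p - 1) / Gamma (2 * p))\<bar>"
      by (rule abs_triangle_ineq4)
    also have "\<bar>C * (b n - ?N powr (2 * p - 1) / Gamma (2 * p))\<bar> = C * \<bar>b n - ?N powr (2 * p - 1) / Gamma (2 * p)\<bar>"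
      using C by (simp add: abs_mult)
    finally show "\<bar>R_p p (Suc n) - (- (1 - 2*p) / (p * Gamma (2*p)) * ?N powr (2*p - 1))\<bar>
        \<le> (K + C * 4) * real n powr (2 * (2 * p - 1))"
      using 1 2 by (simp add: algebra_simps)
  qed (use p in simp)
qed

section \<open>The logarithmic case \<open>p = 1/2\<close>\<close>

lemma ln_le_4_powr:
  fixes x :: real
  assumes "x \<ge> 1/2"
  shows "\<bar>ln x\<bar> \<le> 4 * x powr (1/4)" "1 \<le> 2 * x powr (1/4)"
proof -
  have x0: "x > 0" using assms by linarith
  \<comment> \<open>\<open>1/16\<close> is a fourth power below \<open>1/2\<close>.\<close>
  have "(1/16 :: real) powr (1/4) \<le> x powr (1/4)" using assms by (intro powr_mono2) auto
  moreover have "(1/16 :: real) powr (1/4) = ((1/2) powr 4) powr (1/4)"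
    by (simp add: power_divide)
  then have "(1/16 :: real) powr (1/4) = 1/2" unfolding powr_powr by simp
  ultimately show 1: "1 \<le> 2 * x powr (1/4)" by simp
  show "\<bar>ln x\<bar> \<le> 4 * x powr (1/4)"
  proof (cases "x \<ge> 1")
    case True
    have "ln x = 4 * ln (x powr (1/4))" using x0 by (simp add: ln_powr)
    also have "ln (x powr (1/4)) \<le> x powr (1/4) - 1" using x0 by (intro ln_le_minus_one) simp
    finally show ?thesis using True by simp
  next
    case False
    have "ln (1 / x) \<le> 1 / x - 1" using x0 by (intro ln_le_minus_one) simp
    also have "\<dots> \<le> 1" using assms x0 by (simp add: field_simps)
    finally have "- ln x \<le> 1" using x0 by (simp add: ln_div)
    moreover have "ln x \<le> 0" using False x0 by simp
    ultimately show ?thesis using 1 by linarith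
  qed
qed

lemma ln_squared_le:
  fixes x :: real
  assumes "x \<ge> 1"
  shows "(ln x)\<^sup>2 \<le> 16 * x powr (1/2)"
proof -
  have "\<bar>ln x\<bar> ^ 2 \<le> (4 * x powr (1/4)) ^ 2"
    using ln_le_4_powr(1)[of x] assms by (intro power_mono) auto
  also have "\<dots> = 16 * (x powr (1/4) * x powr (1/4))" by (simp add: power2_eq_square)
  also have "x powr (1/4) * x powr (1/4) = x powr (1/2)" by (simp flip: powr_add)
  finally show ?thesis by simp
qed

text \<open>The factor \<open>1 + Ln (1 - z) / 2\<close> is replaced by the constant
  \<open>1 - l / 2\<close>. The two differ by about half of \<open>ln (n |1 - z|)\<close>, which is
  \<open>O(1)\<close> at the scale \<open>1/n\<close> that matters and elsewhere at most a small
  power of \<open>n |1 - z|\<close>. With total power \<open>1/2\<close>, the transfer at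
  \<open>a = 1/2\<close> returns an error of order \<open>1 / l^2\<close>.\<close>

lemma gf_half_near_one:
  fixes n :: nat and z :: complex
  defines "l \<equiv> ln (real n)"
  assumes n: "l \<ge> 4" "n > 0" and z: "z \<in> wide_sector"
    and small: "1 / (2 * real n) \<le> norm (1 - z)" "norm (1 - z) \<le> exp (- 4)"
  shows "norm (1 / gf_denom (1/2) z - 1 / (of_real (1 - l / 2) * (1 - z)))
           \<le> 576 * (real n powr (1/2) / l\<^sup>2) * norm (1 - z) powr (- 1/2)"
proof -
  define \<zeta> where "\<zeta> = 1 - z"
  have \<zeta>: "\<zeta> \<noteq> 0" using z by (auto simp: wide_sector_def \<zeta>_def)
  then have n\<zeta>: "norm \<zeta> > 0" by simp
  define L where "L = Ln \<zeta>"
  define t where "t = - ln (norm \<zeta>)"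
  define A where "A = 1 + L / 2"
  define c where "c = 1 - l / 2"
  define x where "x = real n * norm \<zeta>"
  define y where "y = \<bar>l - t\<bar>"
  have ReL: "Re L = - t" using \<zeta> by (simp add: L_def t_def)
  have ImL: "\<bar>Im L\<bar> \<le> pi" using \<zeta> mpi_less_Im_Ln[of \<zeta>] Im_Ln_le_pi[of \<zeta>] by (simp add: L_def)
  have t: "t \<ge> 4"
  proof -
    have "ln (norm \<zeta>) \<le> ln (exp (- 4))" using small n\<zeta> by (subst ln_le_cancel_iff) (auto simp: \<zeta>_def)
    then show ?thesis by (simp add: t_def)
  qed
  have x: "x \<ge> 1/2" using small n by (simp add: x_def \<zeta>_def field_simps)
  have y: "y = \<bar>ln x\<bar>" using n n\<zeta> by (simp add: y_def x_def t_def l_def ln_mult)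
  have W: "gf_denom (1/2) z = \<zeta> * A"
    by (simp add: gf_denom_def psi_def A_def L_def \<zeta>_def)
  \<comment> \<open>From \<open>t \<ge> 4\<close>, hence the radius \<open>exp (- 4)\<close>: the
    real part \<open>1 - t / 2\<close> is then at most \<open>- t / 4\<close>.\<close>
  have A: "norm A \<ge> t / 4"
  proof -
    have "\<bar>Re A\<bar> \<ge> t / 4" using t ReL by (simp add: A_def)
    then show ?thesis using abs_Re_le_cmod[of A] by linarith
  qed
  have c: "\<bar>c\<bar> \<ge> l / 4" using n by (simp add: c_def)
  have Anz: "A \<noteq> 0" using A t by auto
  have cnz: "c \<noteq> 0" using c n by auto
  have cnz': "complex_of_real c \<noteq> 0" using cnz by simp
  have "1 / gf_denom (1/2) z - 1 / (of_real c * \<zeta>) = (of_real c - A) / (\<zeta> * A * of_real c)"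
    unfolding W using Anz cnz' \<zeta> by (simp add: field_simps)
  also have "of_real c - A = - (of_real l + L) / 2" by (simp add: c_def A_def field_simps)
  finally have "norm (1 / gf_denom (1/2) z - 1 / (of_real c * \<zeta>)) =
      norm (of_real l + L) / 2 / (norm \<zeta> * norm A * \<bar>c\<bar>)"
    by (simp add: norm_divide norm_mult norm_minus_cancel del: minus_add_distrib)
  also have "\<dots> \<le> (y + 4) / 2 / (norm \<zeta> * (t / 4) * (l / 4))"
  proof (intro frac_le divide_right_mono mult_mono)
    have "norm (of_real l + L) \<le> \<bar>Re (of_real l + L)\<bar> + \<bar>Im (of_real l + L)\<bar>" by (rule cmod_le)
    also have "\<dots> \<le> y + 4" using ImL pi_less_4 ReL by (simp add: y_def)
    finally show "norm (of_real l + L) \<le> y + 4" .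
  qed (use A c n t n\<zeta> in \<open>auto simp: y_def\<close>)
  also have "\<dots> = 8 * (y + 4) * (1 / t) / (norm \<zeta> * l)" using t n n\<zeta> by (simp add: field_simps)
  \<comment> \<open>Trades \<open>1 / t\<close>, which depends on \<open>z\<close>, for a second
    factor \<open>1 / l\<close>, using \<open>l \<le> t + y\<close>.\<close>
  also have "\<dots> \<le> 8 * (y + 4) * ((1 + y) / l) / (norm \<zeta> * l)"
  proof (intro divide_right_mono mult_left_mono)
    have "l \<le> t + y * 1" by (simp add: y_def)
    also have "\<dots> \<le> t + y * t" using t by (intro add_left_mono mult_left_mono) (auto simp: y_def)
    finally show "1 / t \<le> (1 + y) / l" using t n by (simp add: field_simps)
  qed (use n in \<open>auto simp: y_def\<close>)
  also have "\<dots> = 8 * ((y + 4) * (1 + y)) / (norm \<zeta> * l\<^sup>2)"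
    using n n\<zeta> by (simp add: power2_eq_square field_simps)
  also have "\<dots> \<le> 8 * (72 * x powr (1/2)) / (norm \<zeta> * l\<^sup>2)"
  proof (intro divide_right_mono mult_left_mono)
    let ?w = "x powr (1/4)"
    \<comment> \<open>With \<open>y \<le> 4 w\<close> and \<open>1 \<le> 2 w\<close> the factors are
      at most \<open>12 w\<close> and \<open>6 w\<close>; this needs \<open>x \<ge> 1/2\<close>,
      that is, \<open>|1 - z| \<ge> 1/(2n)\<close>.\<close>
    have "(y + 4) * (1 + y) \<le> (12 * ?w) * (6 * ?w)"
      using ln_le_4_powr[OF x] unfolding y by (intro mult_mono) auto
    also have "\<dots> = 72 * (?w * ?w)" by simp
    also have "?w * ?w = x powr (1/2)" by (simp flip: powr_add)
    finally show "(y + 4) * (1 + y) \<le> 72 * x powr (1/2)" .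
  qed auto
  also have "\<dots> = 576 * (real n powr (1/2) / l\<^sup>2) * (norm \<zeta> powr (1/2) / norm \<zeta>)"
    using n n\<zeta> by (simp add: x_def powr_mult mult_ac)
  also have "norm \<zeta> powr (1/2) / norm \<zeta> = norm \<zeta> powr (- 1/2)"
    using powr_diff[of "norm \<zeta>" "1/2" 1] \<zeta> by simp
  finally show ?thesis by (simp add: \<zeta>_def c_def)
qed

text \<open>As the comparison function changes with \<open>n\<close>, the coefficient bound is
  applied to a different function for each \<open>n\<close>, with a constant proportional to
  \<open>n powr (1/2) / l^2\<close>.\<close>

lemma remainder_half_bound:
  obtains K where "\<And>n. n \<ge> 3 \<Longrightarrow> ln (real n) \<ge> 4 \<Longrightarrow>
    \<bar>R_p (1/2) (Suc n) - 1 / (1 - ln (real n) / 2)\<bar> \<le> K / (ln (real n))\<^sup>2"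
proof -
  define z0 :: real where "z0 = 1 - exp (- 2)"
  have z0: "z0 < 1" and pl: "pole_log (1/2) = - 2" by (simp_all add: z0_def pole_log_def)
  obtain h where h: "h holomorphic_on slit_plane"
    "\<And>z. z \<in> slit_plane \<Longrightarrow> z \<noteq> of_real z0 \<Longrightarrow>
           h z = 1 / gf_denom (1/2) z - 1 / (of_real (1 - 1/2) * (of_real z0 - z))"
    using gf_minus_pole_holomorphic[of "1/2"] unfolding pl z0_def[symmetric] by auto
  have h_fps: "h has_fps_expansion Abs_fps (\<lambda>m. complex_of_real (R_p (1/2) (Suc m)))"
    by (rule remainder_fps) (use h(2) in \<open>auto simp only: pl z0_def[symmetric]\<close>)
  obtain B where B: "\<And>z. z \<in> wide_sector \<Longrightarrow> exp (- 4) \<le> norm (1 - z) \<Longrightarrow> norm (1 - z) \<le> 3 \<Longrightarrow>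
      norm (h z) \<le> B * norm (1 - z) powr (- (1/2))"
    using bounded_wide_sector_annulus[OF h(1), of "exp (- 4)" 3 "1/2"] by auto
  define P :: real where "P = 4 * exp 2"
  define Q where "Q = P + \<bar>B\<bar> + exp 4"
  show ?thesis
  proof (rule that[of "5000 * (576 + 16 * Q)"])
    fix n :: nat assume n: "n \<ge> 3" and l4: "ln (real n) \<ge> 4"
    define l where "l = ln (real n)"
    define c where "c = complex_of_real (1 - l / 2)"
    define T where "T = real n powr (1/2) / l\<^sup>2"
    have l: "l \<ge> 4" using l4 by (simp add: l_def)
    have nc: "norm c \<ge> 1" unfolding c_def norm_of_real using l by simp
    have cnz: "c \<noteq> 0" using nc by auto
    \<comment> \<open>Logarithms grow slower than powers, so contributions bounded independently of
      \<open>n\<close> are absorbed into \<open>T\<close>.\<close>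
    have T: "1 \<le> 16 * T"
      using ln_squared_le[of "real n"] n l by (simp add: T_def l_def field_simps)
    have T0: "T \<ge> 0" by (simp add: T_def)
    have PQ: "P \<ge> 0" "Q \<ge> 0" by (simp_all add: P_def Q_def)
    define g where "g = (\<lambda>z. h z - 1 / (c * (1 - z)))"
    have g_hol: "g holomorphic_on slit_plane"
      unfolding g_def using cnz slit_plane_not_1 by (intro holomorphic_intros h) auto
    have g_fps: "g has_fps_expansion Abs_fps (\<lambda>m. complex_of_real (R_p (1/2) (Suc m))) - Abs_fps (\<lambda>n. 1 / c * (1 / 1) ^ Suc n)"
      unfolding g_def using cnz by (intro has_fps_expansion_diff h_fps simple_pole_fps) auto
    have bound: "norm (g z) \<le> ((576 + 16 * Q) * T) * norm (1 - z) powr (- (1/2))"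
      if z: "z \<in> wide_sector" "1 / (2 * real n) \<le> norm (1 - z)" "norm (1 - z) \<le> 3" for z
    proof (cases "norm (1 - z) \<le> exp (- 4)")
      case True
      define w where "w = norm (1 - z) powr (- (1/2))"
      have e: "exp (- 4 :: real) \<le> (1 - z0) / 2"
      proof -
        have "exp (- 2 :: real) \<le> 1 / 2" using exp_ge_add_one_self[of 2] by (simp add: exp_minus field_simps)
        then have "exp (- 2) * exp (- 2) \<le> exp (- 2) * (1 / 2 :: real)" by (intro mult_left_mono) auto
        then show ?thesis by (simp add: z0_def flip: exp_add)
      qed
      have z': "norm (1 - z) \<le> (1 - z0) / 2" using True e by linarith
      note pole = pole_part_bounds[OF z0 _ z', of "1 - 1/2"]
      have pos: "norm (1 - z) > 0" using z by (auto simp: wide_sector_def)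
      have w1: "w \<ge> 1"
      proof -
        have "norm (1 - z) \<le> 1" using True by (rule order_trans) simp
        then have "1 powr (- (1/2)) \<le> norm (1 - z) powr (- (1/2))" using pos by (intro powr_mono2') auto
        then show ?thesis by (simp add: w_def)
      qed
      have "g z = (1 / gf_denom (1/2) z - 1 / (c * (1 - z))) - 1 / (of_real (1 - 1/2) * (of_real z0 - z))"
        using h(2)[of z] z wide_sector_subset pole(3) by (auto simp: g_def)
      also have "norm \<dots> \<le> 576 * T * w + P"
      proof (rule order_trans[OF norm_triangle_ineq4], rule add_mono)
        show "norm (1 / gf_denom (1/2) z - 1 / (c * (1 - z))) \<le> 576 * T * w"
          using gf_half_near_one[of n z] l n z True by (simp add: c_def T_def w_def l_def)
        have "2 / ((1 - 1/2) * (1 - z0)) = P" by (simp add: z0_def P_def exp_minus field_simps)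
        then show "norm (1 / (of_real (1 - 1/2) * (of_real z0 - z))) \<le> P" using pole(2) by simp
      qed
      finally have 1: "norm (g z) \<le> 576 * T * w + P" .
      have "P \<le> Q * 1 * 1" by (simp add: Q_def)
      also have "Q * 1 * 1 \<le> Q * (16 * T) * w"
        using PQ T w1 by (intro mult_mono) auto
      finally have "norm (g z) \<le> 576 * T * w + Q * (16 * T) * w" using 1 by linarith
      then show ?thesis by (simp add: w_def algebra_simps)
    next
      case False
      define w where "w = norm (1 - z) powr (- (1/2))"
      have pos: "norm (1 - z) > 0" using z by (auto simp: wide_sector_def)
      have "norm (g z) \<le> norm (h z) + norm (1 / (c * (1 - z)))"
        unfolding g_def by (rule norm_triangle_ineq4)
      also have "\<dots> \<le> B * w + exp 4 * w"
      proof (rule add_mono)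
        show "norm (h z) \<le> B * w" unfolding w_def using B z False by simp
        have "norm (1 / (c * (1 - z))) = 1 / norm c * (1 / norm (1 - z))" by (simp add: norm_divide norm_mult)
        also have "\<dots> \<le> 1 * (w * w)"
        proof (rule mult_mono)
          have "w * w = norm (1 - z) powr (- 1)" by (simp add: w_def flip: powr_add)
          then show "1 / norm (1 - z) \<le> w * w" using pos by (simp add: powr_minus_divide)
        qed (use nc in \<open>auto simp: divide_le_eq_1\<close>)
        finally have 1: "norm (1 / (c * (1 - z))) \<le> w * w" by simp
        have "w \<le> exp (- 4) powr (- (1/2))" unfolding w_def using False by (intro powr_mono2') auto
        also have "\<dots> \<le> exp 4" by (simp add: powr_def)
        finally have "w * w \<le> exp 4 * w" by (rule mult_right_mono) (simp add: w_def)
        with 1 show "norm (1 / (c * (1 - z))) \<le> exp 4 * w" by linarith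
      qed
      also have "\<dots> = (B + exp 4) * 1 * w" by (simp add: algebra_simps)
      also have "\<dots> \<le> Q * (16 * T) * w"
      proof (intro mult_mono)
        show "B + exp 4 \<le> Q" using PQ(1) unfolding Q_def by linarith
      qed (use PQ T in \<open>auto simp: w_def\<close>)
      also have "\<dots> \<le> ((576 + 16 * Q) * T) * w"
        using T0 by (intro mult_right_mono) (auto simp: w_def algebra_simps)
      finally show ?thesis by (simp add: w_def)
    qed
    have "complex_of_real (R_p (1/2) (Suc n) - 1 / (1 - l / 2)) =
        (Abs_fps (\<lambda>m. complex_of_real (R_p (1/2) (Suc m))) - Abs_fps (\<lambda>n. 1 / c * (1 / 1) ^ Suc n)) $ n"
      by (simp add: c_def)
    also have "\<dots> = (deriv ^^ n) g 0 / fact n" by (rule fps_nth_fps_expansion[OF g_fps])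
    also have "norm \<dots> \<le> 5000 * ((576 + 16 * Q) * T) * real n powr (1/2 - 1)"
      by (rule coeff_transfer_bound[OF _ _ n g_hol bound]) auto
    also have "\<dots> = 5000 * (576 + 16 * Q) / l\<^sup>2 * (real n powr (1/2) * real n powr (1/2 - 1))"
      by (simp add: T_def)
    also have "real n powr (1/2) * real n powr (1/2 - 1) = 1" using n by (simp flip: powr_add)
    finally show "\<bar>R_p (1/2) (Suc n) - 1 / (1 - ln (real n) / 2)\<bar> \<le> 5000 * (576 + 16 * Q) / (ln (real n))\<^sup>2"
      unfolding norm_of_real l_def by simp
  qed
qed

text \<open>The main term comes from \<open>1 / (1 - l / 2) = - 2 / l + O(1 / l^2)\<close>; the
  shift from \<open>ln (n - 1)\<close> to \<open>ln n\<close> is of lower order.\<close>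

lemma asymptotics_half:
  "(\<lambda>n. R_p (1/2) n - (- 2 / ln (real n))) \<in> O(\<lambda>n. 1 / (ln (real n))\<^sup>2)"
proof -
  obtain K where K: "\<And>n. n \<ge> 3 \<Longrightarrow> ln (real n) \<ge> 4 \<Longrightarrow>
    \<bar>R_p (1/2) (Suc n) - 1 / (1 - ln (real n) / 2)\<bar> \<le> K / (ln (real n))\<^sup>2"
    using remainder_half_bound by blast
  have "(\<lambda>n. R_p (1/2) n - 1 / (1 - ln (real n - 1) / 2)) \<in> O(\<lambda>n. 1 / (ln (real n - 1))\<^sup>2)"
  proof (rule bigoI[of _ K])
    have "eventually (\<lambda>n. ln (real n - 1) \<ge> 4) sequentially" by real_asymp
    then show "eventually (\<lambda>n. norm (R_p (1/2) n - 1 / (1 - ln (real n - 1) / 2)) \<le>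
        K * norm (1 / (ln (real n - 1))\<^sup>2)) sequentially"
      using eventually_ge_at_top[of 4]
    proof eventually_elim
      case (elim n)
      then show ?case using K[of "n - 1"] by (simp add: of_nat_diff)
    qed
  qed
  also have "(\<lambda>n. 1 / (ln (real n - 1))\<^sup>2) \<in> O(\<lambda>n. 1 / (ln (real n))\<^sup>2)" by real_asymp
  finally have "(\<lambda>n. R_p (1/2) n - 1 / (1 - ln (real n - 1) / 2)) \<in> O(\<lambda>n. 1 / (ln (real n))\<^sup>2)" .
  moreover have "(\<lambda>n. 1 / (1 - ln (real n - 1) / 2) - (- 2 / ln (real n))) \<in> O(\<lambda>n. 1 / (ln (real n))\<^sup>2)"
    by real_asymp
  ultimately have "(\<lambda>n. (R_p (1/2) n - 1 / (1 - ln (real n - 1) / 2)) +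
      (1 / (1 - ln (real n - 1) / 2) - (- 2 / ln (real n)))) \<in> O(\<lambda>n. 1 / (ln (real n))\<^sup>2)"
    by (rule sum_in_bigo)
  then show ?thesis by simp
qed

theorem theorem3:
  fixes p :: real
  assumes "0 < p" and "p < 1"
  shows "(p \<noteq> 1/2 \<longrightarrow> (\<forall>n\<ge>1. EP p n =
            (\<Sum>j=0..n-1. (-1) ^ (n + j - 1) * (((2*p - 1) * real j - 1) gchoose (n - 1))
               * (\<Sum>k=0..n-1. real (k choose j) * (p / (2*p - 1)) ^ k))))
       \<and> (p = 1/2 \<longrightarrow> (\<forall>n\<ge>1. EP p n =
            (\<Sum>k=0..n-1. (-1) ^ k / 2 ^ k *
               complete_bell k (\<lambda>m. - fact (m - 1) * gen_harmonic m (n - 1)))))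
       \<and> (p < 1/2 \<longrightarrow>
            (\<lambda>n. R_p p n - (- (1 - 2*p) / (p * Gamma (2*p)) * real n powr (2*p - 1)))
              \<in> O(\<lambda>n. real n powr (2 * (2*p - 1))))
       \<and> (p = 1/2 \<longrightarrow>
            (\<lambda>n. R_p p n - (- 2 / ln (real n))) \<in> O(\<lambda>n. 1 / (ln (real n))^2))
       \<and> (1/2 < p \<longrightarrow>
            (\<lambda>n. R_p p n - (- (2*p - 1) / (1 - p))) \<in> O(\<lambda>n. real n powr (1 - 2*p)))"
proof (intro conjI impI allI)
  fix n :: nat assume "p \<noteq> 1/2" "n \<ge> 1"
  then show "EP p n = (\<Sum>j=0..n-1. (-1) ^ (n + j - 1) * (((2*p - 1) * real j - 1) gchoose (n - 1))
               * (\<Sum>k=0..n-1. real (k choose j) * (p / (2*p - 1)) ^ k))"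
    using EP_generic[OF assms, of "n - 1"] by (simp add: atMost_atLeast0)
next
  fix n :: nat assume p: "p = 1/2" and "n \<ge> 1"
  then show "EP p n = (\<Sum>k=0..n-1. (-1) ^ k / 2 ^ k *
               complete_bell k (\<lambda>m. - fact (m - 1) * gen_harmonic m (n - 1)))"
    unfolding p using EP_half[of "n - 1"] by (simp add: atMost_atLeast0)
next
  assume "p = 1/2"
  then show "(\<lambda>n. R_p p n - (- 2 / ln (real n))) \<in> O(\<lambda>n. 1 / (ln (real n))^2)"
    using asymptotics_half by blast
qed (use assms asymptotics_below_half asymptotics_above_half in blast)+

end
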